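(* Let $d\ge1$ be an integer and let $\mathcal{F}$ be a uniform subdivision of $(d-1)$-dimensional simplicial complexes, with transformation matrix $H_{\mathcal F}=[p_d(i,j)]_{0\le i,j\le d}$. If $\mathcal{F}$ has the interlacing property, i.e. if the sequence of column generating polynomials $\big(P_{d,0}(x),P_{d,1}(x),\dots,P_{d,d}(x)\big)$, $P_{d,k}(x)=\sum_{i=0}^d p_d(i,k)x^i$, is an interlacing sequence, then $H_{\mathcal F}$ is TP$_2$, i.e. all entries and all $2\times 2$ minors of $H_{\mathcal F}$ are non-negative.
   Context: Rows and columns of matrices are indexed starting from $0$. All simplicial complexes are finite. Uniform subdivisions. A triangulation $\Delta'$ of a simplicial complex $\Delta$ is a simplicial complex having a geometric realization that subdivides a geometric realization of $\Delta$; for a face $F\in\Delta$, the restriction $\Delta'_F$ is the subcomplex of $\Delta'$ triangulating $F$. Let $\mathcal{F}=(f_{\mathcal F}(i,j))_{0\le i\le j\le d}$ be a triangular array of non-negative integers. A triangulation $\Delta'$ of a $(d-1)$-dimensional complex $\Delta$ is $\mathcal{F}$-uniform if, for all $0\le i\le j\le d$ and every $(j-1)$-dimensional face $F$ of $\Delta$, the restriction $\Delta'_F$ has exactly $f_{\mathcal F}(i,j)$ faces of dimension $i-1$ (so the face numbers of the restriction depend only on $\dim F$). One calls $\mathcal{F}$ a uniform subdivision (uniform triangulation) of $(d-1)$-dimensional complexes when it is the array of an $\mathcal F$-uniform triangulation of some $(d-1)$-dimensional simplicial complex. Transformation matrix. For a $(d-1)$-dimensional complex $\Delta$ with $f_{i-1}$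 faces of dimension $i-1$ ($f_{-1}=1$), the $h$-vector $(h_0,\dots,h_d)$ is defined by $\sum_{i=0}^d h_i x^i=\sum_{i=0}^d f_{i-1}x^i(1-x)^{d-i}$. If $\Delta'$ is an $\mathcal{F}$-uniform triangulation of $\Delta$ then the face numbers $f'_{i-1}$ of $\Delta'$ satisfy $f'_{i-1}=\sum_{j=0}^d g(i,j)f_{j-1}$ with $g(i,j)=\sum_{k=0}^{j}(-1)^{j-k}\binom{j}{k}f_{\mathcal F}(i,k)$ (where $f_{\mathcal F}(i,k)=0$ for $i>k$). The transformation matrix $H_{\mathcal F}=[p_d(i,j)]_{0\le i,j\le d}$ is the matrix of this linear map $\mathbb{R}^{d+1}\to\mathbb{R}^{d+1}$ expressed in the $h$-coordinates (via the displayed invertible linear relation between $f$- and $h$-vectors, for source and target); thus $h^{\Delta'}=H_{\mathcal F}\,h^{\Delta}$ (column vectors) for every $(d-1)$-dimensional $\Delta$ and every $\mathcal{F}$-uniform triangulation $\Delta'$ of $\Delta$. Interlacing. For real-rooted $f,g\in\mathbb{R}[x]$ with positive leading coefficients, write $f\preceq g$ if $\cdots\le r_2(f)\le r_2(g)\le r_1(f)\le r_1(g)$, where $r_1\ge r_2\ge\cdots$ denote the zeros (with multiplicity) in non-increasing order; in particular $\deg g\in\{\deg f,\deg f+1\}$. By convention $0\preceq 0$, $0\preceq h$ and $h\preceq 0$ for every real-rooted $h$ with positive leading coefficient. A sequence $(f_0,\dots,f_n)$ of real-rooted polynomials is interlacing if $f_i\preceq f_j$ for all $0\le i<j\le n$.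 *)

theory Defs
  imports
    "HOL-Analysis.Polytope"
    "HOL-Computational_Algebra.Polynomial"
    "Jordan_Normal_Form.Determinant"
begin

hide_const (open) Finite_Cartesian_Product.vec Finite_Cartesian_Product.mat
hide_type (open) Finite_Cartesian_Product.vec
no_notation vec_nth (infixl \<open>$\<close> 90)

section \<open>Uniform subdivisions\<close>

text \<open>
  Complexes are given by their geometric realizations, using the library notion
  \<^const>\<open>simplicial_complex\<close>: a finite family of simplices (as point sets). A nonempty
  complex contains the empty face, which has dimension \<open>-1\<close> (\<^const>\<open>aff_dim\<close>).
\<close>

definition has_complex_dim :: "'a::euclidean_space set set \<Rightarrow> int \<Rightarrow> bool" where
  "has_complex_dim \<Delta> m \<longleftrightarrow> (\<exists>S\<in>\<Delta>. aff_dim S = m) \<and> (\<forall>S\<in>\<Delta>. aff_dim S \<le> m)"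

definition subdivides :: "'a::euclidean_space set set \<Rightarrow> 'a set set \<Rightarrow> bool" where
  "subdivides \<Delta>' \<Delta> \<longleftrightarrow>
     simplicial_complex \<Delta>' \<and> simplicial_complex \<Delta> \<and>
     \<Union>\<Delta>' = \<Union>\<Delta> \<and> (\<forall>G\<in>\<Delta>'. \<exists>F\<in>\<Delta>. G \<subseteq> F)"

definition restriction :: "'a set set \<Rightarrow> 'a set \<Rightarrow> 'a set set" where
  "restriction \<Delta>' F = {G \<in> \<Delta>'. G \<subseteq> F}"

definition face_number :: "'a::euclidean_space set set \<Rightarrow> int \<Rightarrow> nat" where
  "face_number \<Delta> m = card {G \<in> \<Delta>. aff_dim G = m}"

text \<open>The array \<open>(f(i,j))\<close> is a function of which only the values with \<open>i \<le> j \<le> d\<close> are used.\<close>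

definition uniform_triangulation ::
    "nat \<Rightarrow> (nat \<Rightarrow> nat \<Rightarrow> nat) \<Rightarrow> 'a::euclidean_space set set \<Rightarrow> 'a set set \<Rightarrow> bool" where
  "uniform_triangulation d f \<Delta>' \<Delta> \<longleftrightarrow>
     has_complex_dim \<Delta> (int d - 1) \<and> subdivides \<Delta>' \<Delta> \<and>
     (\<forall>i j. i \<le> j \<and> j \<le> d \<longrightarrow>
       (\<forall>F\<in>\<Delta>. aff_dim F = int j - 1 \<longrightarrow> face_number (restriction \<Delta>' F) (int i - 1) = f i j))"

text \<open>The type argument is the Euclidean space in which the realizations live.\<close>

definition uniform_subdivision ::
    "'a::euclidean_space itself \<Rightarrow> nat \<Rightarrow> (nat \<Rightarrow> nat \<Rightarrow> nat) \<Rightarrow> bool" where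
  "uniform_subdivision _ d f \<longleftrightarrow> (\<exists>\<Delta>' \<Delta> :: 'a set set. uniform_triangulation d f \<Delta>' \<Delta>)"


section \<open>The transformation matrix\<close>

text \<open>
  A face vector of a complex of dimension \<open>d - 1\<close> is indexed so that entry \<open>i\<close> is the number
  of faces of dimension \<open>i - 1\<close>.
\<close>

definition h_of_f :: "nat \<Rightarrow> real vec \<Rightarrow> real vec" where
  "h_of_f d v = vec (d + 1)
     (\<lambda>k. coeff (\<Sum>i\<le>d. smult (v $ i) (monom 1 i * [:1, -1:] ^ (d - i))) k)"

definition f_transformation_matrix :: "nat \<Rightarrow> (nat \<Rightarrow> nat \<Rightarrow> nat) \<Rightarrow> real mat" where
  "f_transformation_matrix d f = mat (d + 1) (d + 1)
     (\<lambda>(i, j). \<Sum>k\<le>j. (-1) ^ (j - k) * real (j choose k) * (if i \<le> k then real (f i k) else 0))"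

text \<open>The matrix of the same linear map in \<open>h\<close>-coordinates; it exists and is unique by
  \<open>transformation_matrix_ex1\<close> below.\<close>

definition transformation_matrix :: "nat \<Rightarrow> (nat \<Rightarrow> nat \<Rightarrow> nat) \<Rightarrow> real mat" where
  "transformation_matrix d f =
     (THE H. H \<in> carrier_mat (d + 1) (d + 1) \<and>
       (\<forall>v\<in>carrier_vec (d + 1). H *\<^sub>v h_of_f d v = h_of_f d (f_transformation_matrix d f *\<^sub>v v)))"

definition h_of_f_mat :: "nat \<Rightarrow> real mat" where
  "h_of_f_mat d = mat (d + 1) (d + 1) (\<lambda>(k, i). coeff (monom 1 i * [:1, -1:] ^ (d - i)) k)"

lemma h_of_f_mat_carrier [simp]: "h_of_f_mat d \<in> carrier_mat (d + 1) (d + 1)"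
  by (simp add: h_of_f_mat_def)

lemma f_transformation_matrix_carrier [simp]:
  "f_transformation_matrix d f \<in> carrier_mat (d + 1) (d + 1)"
  by (simp add: f_transformation_matrix_def)

lemma h_of_f_eq_mult:
  assumes "v \<in> carrier_vec (d + 1)"
  shows "h_of_f d v = h_of_f_mat d *\<^sub>v v"
proof (rule eq_vecI)
  show "dim_vec (h_of_f d v) = dim_vec (h_of_f_mat d *\<^sub>v v)"
    by (simp add: h_of_f_def h_of_f_mat_def)
next
  fix k assume "k < dim_vec (h_of_f_mat d *\<^sub>v v)"
  then have k: "k < d + 1" by (simp add: h_of_f_mat_def)
  have "{0..<Suc d} = {..d}" by auto
  with assms k show "h_of_f d v $ k = (h_of_f_mat d *\<^sub>v v) $ k"
    by (auto simp: h_of_f_def h_of_f_mat_def scalar_prod_def coeff_sum mult.commute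
        intro!: sum.cong simp del: mult_pCons_left mult_pCons_right)
qed

lemma det_h_of_f_mat: "det (h_of_f_mat d) = 1"
proof -
  have "det (h_of_f_mat d) = prod_list (diag_mat (h_of_f_mat d))"
    by (rule det_lower_triangular[OF _ h_of_f_mat_carrier])
       (auto simp: h_of_f_mat_def coeff_monom_mult)
  also have "diag_mat (h_of_f_mat d) = map (\<lambda>_. 1) [0..<d + 1]"
    unfolding diag_mat_def
    by (rule map_cong) (auto simp: h_of_f_mat_def coeff_monom_mult coeff_0_power)
  finally show ?thesis by (simp add: map_replicate_const)
qed

lemma transformation_matrix_ex1:
  "\<exists>!H. H \<in> carrier_mat (d + 1) (d + 1) \<and>
     (\<forall>v\<in>carrier_vec (d + 1). H *\<^sub>v h_of_f d v = h_of_f d (f_transformation_matrix d f *\<^sub>v v))"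
proof -
  define n where "n = d + 1"
  let ?B = "h_of_f_mat d"
  let ?G = "f_transformation_matrix d f"
  have cB: "?B \<in> carrier_mat n n" and cG: "?G \<in> carrier_mat n n"
    unfolding n_def by (rule h_of_f_mat_carrier, rule f_transformation_matrix_carrier)
  have hB: "h_of_f d v = ?B *\<^sub>v v" if "v \<in> carrier_vec n" for v
    using that unfolding n_def by (rule h_of_f_eq_mult)
  have "?B \<in> Units (ring_mat TYPE(real) n ())"
    by (rule det_non_zero_imp_unit[OF cB]) (simp add: det_h_of_f_mat)
  then obtain C where cC: "C \<in> carrier_mat n n" and CB: "C * ?B = 1\<^sub>m n" and BC: "?B * C = 1\<^sub>m n"
    by (auto simp: Units_def ring_mat_simps)
  have mult_unit: "A *\<^sub>v unit_vec n j = col A j"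
    if "A \<in> carrier_mat n n" "j < n" for A :: "real mat" and j
    using col_mult2[OF that(1) one_carrier_mat that(2)] that by simp
  have char: "(\<forall>v\<in>carrier_vec n. H *\<^sub>v h_of_f d v = h_of_f d (?G *\<^sub>v v)) \<longleftrightarrow> H = ?B * ?G * C"
    if cH: "H \<in> carrier_mat n n" for H
  proof
    assume *: "\<forall>v\<in>carrier_vec n. H *\<^sub>v h_of_f d v = h_of_f d (?G *\<^sub>v v)"
    have "H * ?B = ?B * ?G"
    proof (rule mat_col_eqI)
      fix j assume "j < dim_col (?B * ?G)"
      then have j: "j < n" using cG by simp
      have u: "unit_vec n j \<in> carrier_vec n" by simp
      from bspec[OF * u] have "H *\<^sub>v (?B *\<^sub>v unit_vec n j) = ?B *\<^sub>v (?G *\<^sub>v unit_vec n j)"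
        using cG by (simp add: hB)
      then have "(H * ?B) *\<^sub>v unit_vec n j = (?B * ?G) *\<^sub>v unit_vec n j"
        using assoc_mult_mat_vec[OF cH cB u] assoc_mult_mat_vec[OF cB cG u] by simp
      then show "col (H * ?B) j = col (?B * ?G) j"
        using mult_unit[OF mult_carrier_mat[OF cH cB] j]
          mult_unit[OF mult_carrier_mat[OF cB cG] j] by simp
    qed (use cH cB cG in auto)
    then have "H * (?B * C) = ?B * ?G * C"
      using assoc_mult_mat[OF cH cB cC] by simp
    then show "H = ?B * ?G * C" using cH BC by simp
  next
    assume H: "H = ?B * ?G * C"
    show "\<forall>v\<in>carrier_vec n. H *\<^sub>v h_of_f d v = h_of_f d (?G *\<^sub>v v)"
    proof
      fix v :: "real vec" assume v: "v \<in> carrier_vec n"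
      have "H * ?B = ?B * ?G * (C * ?B)"
        unfolding H using assoc_mult_mat[OF mult_carrier_mat[OF cB cG] cC cB] .
      also have "\<dots> = ?B * ?G"
        by (simp only: CB right_mult_one_mat[OF mult_carrier_mat[OF cB cG]])
      finally have HB: "H * ?B = ?B * ?G" .
      have "H *\<^sub>v (?B *\<^sub>v v) = ?B *\<^sub>v (?G *\<^sub>v v)"
        using assoc_mult_mat_vec[OF cH cB v] assoc_mult_mat_vec[OF cB cG v] HB by simp
      moreover have "?G *\<^sub>v v \<in> carrier_vec n" using cG v by simp
      ultimately show "H *\<^sub>v h_of_f d v = h_of_f d (?G *\<^sub>v v)"
        using v by (simp add: hB)
    qed
  qed
  have "?B * ?G * C \<in> carrier_mat n n" using cB cG cC by auto
  with char show ?thesis unfolding n_def[symmetric] by (intro ex1I[of _ "?B * ?G * C"]) auto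
qed

definition column_poly :: "nat \<Rightarrow> real mat \<Rightarrow> nat \<Rightarrow> real poly" where
  "column_poly d H k = (\<Sum>i\<le>d. monom (H $$ (i, k)) i)"


section \<open>Interlacing\<close>

definition real_rooted_pos :: "real poly \<Rightarrow> bool" where
  "real_rooted_pos p \<longleftrightarrow> lead_coeff p > 0 \<and>
     (\<forall>z::complex. poly (map_poly complex_of_real p) z = 0 \<longrightarrow> z \<in> \<real>)"

text \<open>The real zeros in non-increasing order, with multiplicity; the zero \<open>r\<^sub>k\<close> is the list
  entry with index \<open>k - 1\<close>.\<close>

definition zeros_desc :: "real poly \<Rightarrow> real list" where
  "zeros_desc p = rev (sorted_list_of_multiset (proots p))"

definition interlaces :: "real poly \<Rightarrow> real poly \<Rightarrow> bool" (infix \<open>\<preceq>\<^sub>i\<close> 50) where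
  "f \<preceq>\<^sub>i g \<longleftrightarrow>
     f = 0 \<and> g = 0 \<or>
     f = 0 \<and> real_rooted_pos g \<or>
     real_rooted_pos f \<and> g = 0 \<or>
     real_rooted_pos f \<and> real_rooted_pos g \<and>
       degree g \<in> {degree f, degree f + 1} \<and>
       (\<forall>k < degree f. zeros_desc f ! k \<le> zeros_desc g ! k) \<and>
       (\<forall>k. k + 1 < degree g \<longrightarrow> zeros_desc g ! (k + 1) \<le> zeros_desc f ! k)"

text \<open>The zero polynomial counts as real-rooted here, as the convention \<open>0 \<preceq>\<^sub>i 0\<close> suggests.\<close>

definition interlacing_seq :: "nat \<Rightarrow> (nat \<Rightarrow> real poly) \<Rightarrow> bool" where
  "interlacing_seq n P \<longleftrightarrow>
     (\<forall>i\<le>n. P i = 0 \<or> real_rooted_pos (P i)) \<and>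
     (\<forall>i j. i < j \<and> j \<le> n \<longrightarrow> P i \<preceq>\<^sub>i P j)"

definition interlacing_property :: "nat \<Rightarrow> (nat \<Rightarrow> nat \<Rightarrow> nat) \<Rightarrow> bool" where
  "interlacing_property d f \<longleftrightarrow> interlacing_seq d (column_poly d (transformation_matrix d f))"


section \<open>Total positivity of order 2\<close>

definition TP2 :: "real mat \<Rightarrow> bool" where
  "TP2 A \<longleftrightarrow>
     (\<forall>i < dim_row A. \<forall>j < dim_col A. 0 \<le> A $$ (i, j)) \<and>
     (\<forall>i i' j j'. i < i' \<and> i' < dim_row A \<and> j < j' \<and> j' < dim_col A \<longrightarrow>
        0 \<le> A $$ (i, j) * A $$ (i', j') - A $$ (i, j') * A $$ (i', j))"

end

theory Submission
  imports Defs "HOL-Computational_Algebra.Fundamental_Theorem_Algebra"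
begin

text \<open>
  Column \<open>k\<close> of the transformation matrix counts the faces of a triangulated simplex \<open>F\<close> that avoid
  \<open>k\<close> fixed facets of \<open>F\<close>, in \<open>h\<close>-coordinates. Homogenizing, the triangulation becomes a simplicial
  fan; pushing each open cone slightly in the direction of a generic vector, whose barycentric
  coordinates with respect to \<open>F\<close> are negative exactly at the \<open>k\<close> opposite vertices, distributes the
  faces in question over the maximal cones \<open>C\<close>, the share of \<open>C\<close> being an interval \<open>[R C, C]\<close>. Such
  an interval contributes the monomial with exponent \<open>|R C|\<close> to the column polynomial, so all
  entries are non-negative.

  Hence no column polynomial has a positive zero. For two real-rooted polynomials with non-positive
  zeros, domination of the zeros entry by entry already forces the \<open>2 \<times> 2\<close> minors of the coefficients
  to be non-negative, by induction on the linear factors.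
\<close>

no_notation scalar_prod (infix \<open>\<bullet>\<close> 70)

section \<open>Coefficient minors of interlacing polynomials\<close>

lemma poly_map_poly_of_real:
  "poly (map_poly of_real p) (of_real x) = (of_real (poly p x) :: 'a::{real_algebra_1,comm_ring_1})"
  by (induction p) (auto simp: map_poly_pCons)

lemma map_poly_of_real_mult:
  "map_poly of_real (p * q) =
     map_poly of_real p * (map_poly of_real q :: 'a::{real_algebra_1,comm_ring_1} poly)"
  by (simp add: poly_eq_iff coeff_map_poly coeff_mult)

text \<open>Induction on the degree: the fundamental theorem of algebra supplies a complex zero,
  real-rootedness makes it real, so a real linear factor splits off and the quotient is again
  real-rooted with the same leading coefficient.\<close>

lemma real_rooted_pos_factor:
  fixes p :: "real poly"
  assumes "real_rooted_pos p"
  shows "size (proots p) = degree p"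
    and "p = smult (lead_coeff p) (\<Prod>x\<in>#proots p. [:-x, 1:])"
proof -
  have "lead_coeff p > 0 \<Longrightarrow> (\<forall>z::complex. poly (map_poly complex_of_real p) z = 0 \<longrightarrow> z \<in> \<real>) \<Longrightarrow>
      size (proots p) = degree p \<and> p = smult (lead_coeff p) (\<Prod>x\<in>#proots p. [:-x, 1:])"
  proof (induction "degree p" arbitrary: p)
    case 0
    then obtain c where "p = [:c:]" by (metis degree_eq_zeroE)
    then show ?case by simp
  next
    case (Suc n)
    have "\<not> constant (poly (map_poly complex_of_real p))"
      using Suc.hyps by (simp add: constant_degree degree_map_poly)
    then obtain z where z: "poly (map_poly complex_of_real p) z = 0"
      using fundamental_theorem_of_algebra by blast
    with Suc.prems have "z \<in> \<real>" by blast
    then obtain r where r: "z = of_real r" by (auto elim: Reals_cases)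
    have "poly p r = 0" using z unfolding r poly_map_poly_of_real by simp
    then obtain q where q: "p = [:-r, 1:] * q" by (metis poly_eq_0_iff_dvd dvdE)
    have p0: "p \<noteq> 0" using Suc.hyps by auto
    then have q0: "q \<noteq> 0" using q by auto
    have lc: "lead_coeff q = lead_coeff p" by (simp add: q lead_coeff_mult del: mult_pCons_left)
    have deg: "degree p = Suc (degree q)"
      unfolding q using q0 by (subst degree_mult_eq) auto
    have map: "map_poly complex_of_real p = [:-of_real r, 1:] * map_poly complex_of_real q"
      unfolding q map_poly_of_real_mult by (simp add: map_poly_pCons)
    have IH: "size (proots q) = degree q \<and> q = smult (lead_coeff q) (\<Prod>x\<in>#proots q. [:-x, 1:])"
    proof (rule Suc.hyps(1))
      show "n = degree q" using Suc.hyps(2) deg by simp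
      show "0 < lead_coeff q" using Suc.prems lc by simp
      show "\<forall>z. poly (map_poly complex_of_real q) z = 0 \<longrightarrow> z \<in> \<real>"
        using Suc.prems(2) unfolding map by simp
    qed
    have "proots p = proots [:-r, 1:] + proots q"
      unfolding q by (rule proots_mult) (use q0 in auto)
    then have pr: "proots p = add_mset r (proots q)" by simp
    have "p = [:-r, 1:] * smult (lead_coeff q) (\<Prod>x\<in>#proots q. [:-x, 1:])"
      using q IH by simp
    then have "p = smult (lead_coeff p) (\<Prod>x\<in>#proots p. [:-x, 1:])"
      unfolding pr lc by (simp add: mult.commute)
    then show ?case using pr IH deg by simp
  qed
  then show "size (proots p) = degree p" "p = smult (lead_coeff p) (\<Prod>x\<in>#proots p. [:-x, 1:])"
    using assms by (simp_all add: real_rooted_pos_def)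
qed

lemma real_rooted_pos_zeros_desc:
  assumes "real_rooted_pos p"
  shows "length (zeros_desc p) = degree p"
    and "p = smult (lead_coeff p) (\<Prod>x\<leftarrow>zeros_desc p. [:-x, 1:])"
proof -
  have m: "mset (zeros_desc p) = proots p" by (simp add: zeros_desc_def)
  then show "length (zeros_desc p) = degree p"
    using real_rooted_pos_factor(1)[OF assms] by (metis size_mset)
  have "(\<Prod>x\<leftarrow>zeros_desc p. [:-x, 1:]) = (\<Prod>x\<in>#proots p. [:-x, 1:])"
    unfolding m[symmetric] by (metis mset_map prod_mset_prod_list)
  then show "p = smult (lead_coeff p) (\<Prod>x\<leftarrow>zeros_desc p. [:-x, 1:])"
    using real_rooted_pos_factor(2)[OF assms] by simp
qed

text \<open>At a zero \<open>x > 0\<close> all terms of the polynomial are non-negative and sum to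
  0, so even the leading term would vanish.\<close>

lemma zeros_desc_nonpos:
  fixes p :: "real poly"
  assumes "\<And>i. 0 \<le> coeff p i" "x \<in> set (zeros_desc p)"
  shows "x \<le> 0"
proof (rule ccontr)
  assume x: "\<not> x \<le> 0"
  have "set (zeros_desc p) = set_mset (proots p)" by (simp add: zeros_desc_def)
  with assms(2) have "x \<in># proots p" by simp
  then have p0: "p \<noteq> 0" by auto
  with \<open>x \<in># proots p\<close> have "poly p x = 0" by simp
  then have "(\<Sum>i\<le>degree p. coeff p i * x ^ i) = 0" by (simp add: poly_altdef)
  then have "coeff p (degree p) * x ^ degree p = 0"
    using assms(1) x by (subst (asm) sum_nonneg_eq_0_iff) auto
  with p0 x show False by simp
qed

text \<open>Integer indices with value 0 below zero keep the recurrence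
  \<open>int_coeff_linear_mult\<close> free of boundary cases and allow arbitrary shifts
  \<open>i - k\<close>.\<close>

definition int_coeff :: "'a::zero poly \<Rightarrow> int \<Rightarrow> 'a" where
  "int_coeff p i = (if i < 0 then 0 else coeff p (nat i))"

lemma int_coeff_linear_mult:
  "int_coeff ([:a, 1:] * p) i = a * int_coeff p i + int_coeff p (i - 1)"
  for a :: "'a::comm_semiring_1"
  by (auto simp: int_coeff_def coeff_pCons nat_diff_distrib split: nat.splits)

text \<open>The minors are compared for \<open>p\<close> against every shift \<open>x\<^sup>k q\<close>, since the case \<open>k = 0\<close> alone is
  not preserved when both polynomials are multiplied by linear factors.\<close>

definition shift_ratio_le :: "real poly \<Rightarrow> real poly \<Rightarrow> bool" where
  "shift_ratio_le p q \<longleftrightarrow> (\<forall>i j k. i \<le> j \<and> 0 \<le> k \<longrightarrow>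
     int_coeff p j * int_coeff q (i - k) \<le> int_coeff p i * int_coeff q (j - k))"

lemma shift_ratio_le_1: "shift_ratio_le 1 1"
  by (auto simp: shift_ratio_le_def int_coeff_def)

text \<open>The new minor is \<open>b\<close> times the old one for the shift \<open>k\<close> plus
  the old one for the shift \<open>k + 1\<close>. This accounts for a surplus zero of the right-hand
  polynomial.\<close>

lemma shift_ratio_le_mult_right:
  assumes "shift_ratio_le p q" "0 \<le> b"
  shows "shift_ratio_le p ([:b, 1:] * q)"
  unfolding shift_ratio_le_def
proof (intro allI impI)
  fix i j k :: int assume ijk: "i \<le> j \<and> 0 \<le> k"
  have 1: "int_coeff p j * int_coeff q (i - k) \<le> int_coeff p i * int_coeff q (j - k)"
    using assms(1) ijk unfolding shift_ratio_le_def by blast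
  have 2: "int_coeff p j * int_coeff q (i - (k + 1)) \<le> int_coeff p i * int_coeff q (j - (k + 1))"
    using assms(1) ijk unfolding shift_ratio_le_def by (meson add_nonneg_nonneg zero_le_one)
  show "int_coeff p j * int_coeff ([:b, 1:] * q) (i - k) \<le> int_coeff p i * int_coeff ([:b, 1:] * q) (j - k)"
    unfolding int_coeff_linear_mult using mult_left_mono[OF 1 assms(2)] 2
    by (simp add: algebra_simps)
qed

text \<open>The new minor expands into
  \<open>a * b * M i j k + a * X + b * Y + M (i - 1) (j - 1) k\<close>. Here \<open>Y\<close> is the
  minor for the shift \<open>k - 1\<close>, so its sign is in doubt only for \<open>k = 0\<close>;
  there \<open>X\<close> compensates because \<open>b \<le> a\<close>.\<close>

lemma shift_ratio_le_mult:
  assumes T: "shift_ratio_le p q" and ab: "0 \<le> b" "b \<le> a"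
  shows "shift_ratio_le ([:a, 1:] * p) ([:b, 1:] * q)"
  unfolding shift_ratio_le_def
proof (intro allI impI)
  fix i j k :: int assume ijk: "i \<le> j \<and> 0 \<le> k"
  let ?p = "int_coeff p" and ?q = "int_coeff q"
  define M where "M i j k = ?p i * ?q (j - k) - ?p j * ?q (i - k)" for i j k
  have M: "0 \<le> M i j k" if "i \<le> j" "0 \<le> k" for i j k
    using T that unfolding shift_ratio_le_def M_def by simp
  define X where "X = M i j (k + 1)"
  define Y where "Y = ?p (i - 1) * ?q (j - k) - ?p (j - 1) * ?q (i - k)"
  have X0: "0 \<le> X" using M[of i j "k + 1"] ijk unfolding X_def by simp
  have "0 \<le> a * X + b * Y"
  proof (cases "k = 0")
    case False
    have "Y = M (i - 1) (j - 1) (k - 1)" by (simp add: Y_def M_def)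
    then have "0 \<le> Y" using M[of "i - 1" "j - 1" "k - 1"] ijk False by simp
    with X0 ab show ?thesis by simp
  next
    case True
    have "0 \<le> X + Y"
    proof (cases "i = j")
      case True then show ?thesis by (simp add: X_def Y_def M_def)
    next
      case False
      \<comment> \<open>The four products are regrouped into two unshifted minors; the first one
        requires \<open>i \<le> j - 1\<close>, whence the separate case
        \<open>i = j\<close>.\<close>
      have "X + Y = M i (j - 1) 0 + M (i - 1) j 0"
        using True by (simp add: X_def Y_def M_def)
      with M[of i "j - 1" 0] M[of "i - 1" j 0] ijk False show ?thesis by simp
    qed
    then have "0 \<le> b * (X + Y)" using ab by simp
    also have "\<dots> \<le> a * X + b * Y" using mult_right_mono[OF ab(2) X0] by (simp add: algebra_simps)
    finally show ?thesis .
  qed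
  moreover have "0 \<le> a * b * M i j k" "0 \<le> M (i - 1) (j - 1) k"
    using M[of i j k] M[of "i - 1" "j - 1" k] ijk ab by simp_all
  ultimately show "int_coeff ([:a, 1:] * p) j * int_coeff ([:b, 1:] * q) (i - k)
      \<le> int_coeff ([:a, 1:] * p) i * int_coeff ([:b, 1:] * q) (j - k)"
    unfolding int_coeff_linear_mult X_def Y_def M_def by (simp add: algebra_simps)
qed

lemma shift_ratio_le_prod_list:
  assumes "list_all2 (\<lambda>x y. x \<le> y \<and> y \<le> 0) xs ys"
  shows "shift_ratio_le (\<Prod>x\<leftarrow>xs. [:-x, 1:]) (\<Prod>y\<leftarrow>ys. [:-y, 1:])"
  using assms
proof induction
  case Nil
  show ?case using shift_ratio_le_1 by simp
next
  case (Cons x xs y ys)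
  then show ?case using shift_ratio_le_mult[of _ _ "-y" "-x"] by simp
qed

text \<open>Non-negative coefficients make all zeros non-positive. The zeros are paired in
  non-increasing order, a surplus zero of \<open>g\<close> is adjoined last, and the case
  \<open>k = 0\<close> of \<open>shift_ratio_le\<close> is scaled by the leading
  coefficients.\<close>

lemma interlaces_minor_nonneg:
  assumes fg: "f \<preceq>\<^sub>i g" and nonneg: "\<And>i. 0 \<le> coeff f i" "\<And>i. 0 \<le> coeff g i" and "i \<le> j"
  shows "coeff f j * coeff g i \<le> coeff f i * coeff g j"
proof (cases "f = 0 \<or> g = 0")
  case False
  define xs ys where "xs = zeros_desc f" and "ys = zeros_desc g"
  have rr: "real_rooted_pos f" "real_rooted_pos g"
    and deg: "degree g \<in> {degree f, degree f + 1}"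
    and le: "\<And>k. k < degree f \<Longrightarrow> xs ! k \<le> ys ! k"
    using fg False by (auto simp: interlaces_def xs_def ys_def)
  have len: "length xs = degree f" "length ys = degree g"
    using rr by (simp_all add: real_rooted_pos_zeros_desc xs_def ys_def)
  have neg: "y \<le> 0" if "y \<in> set ys" for y
    using zeros_desc_nonpos[OF nonneg(2)] that by (simp add: ys_def)
  \<comment> \<open>If \<open>g\<close> has one zero more than \<open>f\<close>, the truncation
    drops the smallest zero of \<open>g\<close>.\<close>
  have "list_all2 (\<lambda>x y. x \<le> y \<and> y \<le> 0) xs (take (degree f) ys)"
    using deg by (auto simp: list_all2_conv_all_nth len le intro!: neg)
  then have T: "shift_ratio_le (\<Prod>x\<leftarrow>xs. [:-x, 1:]) (\<Prod>y\<leftarrow>take (degree f) ys. [:-y, 1:])"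
    by (rule shift_ratio_le_prod_list)
  have "shift_ratio_le (\<Prod>x\<leftarrow>xs. [:-x, 1:]) (\<Prod>y\<leftarrow>ys. [:-y, 1:])"
  proof (cases "degree g = degree f")
    case True
    then show ?thesis using T len by simp
  next
    case False
    with deg len have "length ys = Suc (degree f)" by simp
    then have ys: "ys = take (degree f) ys @ [ys ! degree f]"
      by (metis lessI order_refl take_Suc_conv_app_nth take_all)
    have "ys ! degree f \<le> 0" using \<open>length ys = Suc (degree f)\<close> by (intro neg) simp
    moreover have "(\<Prod>y\<leftarrow>take (degree f) ys @ [ys ! degree f]. [:-y, 1:]) =
        [:- (ys ! degree f), 1:] * (\<Prod>y\<leftarrow>take (degree f) ys. [:-y, 1:])"
      by (simp only: map_append prod_list.append list.map prod_list.Cons prod_list.Nil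
          mult_1_right mult.commute)
    ultimately show ?thesis
      using shift_ratio_le_mult_right[OF T, of "- (ys ! degree f)"] ys
      by (metis neg_0_le_iff_le)
  qed
  then have "int_coeff (\<Prod>x\<leftarrow>xs. [:-x, 1:]) (int j) * int_coeff (\<Prod>y\<leftarrow>ys. [:-y, 1:]) (int i - 0)
      \<le> int_coeff (\<Prod>x\<leftarrow>xs. [:-x, 1:]) (int i) * int_coeff (\<Prod>y\<leftarrow>ys. [:-y, 1:]) (int j - 0)"
    using \<open>i \<le> j\<close> unfolding shift_ratio_le_def by (meson order_refl of_nat_mono)
  then have le: "coeff (\<Prod>x\<leftarrow>xs. [:-x, 1:]) j * coeff (\<Prod>y\<leftarrow>ys. [:-y, 1:]) i
      \<le> coeff (\<Prod>x\<leftarrow>xs. [:-x, 1:]) i * coeff (\<Prod>y\<leftarrow>ys. [:-y, 1:]) j"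
    by (simp add: int_coeff_def)
  have "0 \<le> lead_coeff f * lead_coeff g" using nonneg by simp
  note main = mult_left_mono[OF le this]
  have cf: "coeff f i = lead_coeff f * coeff (\<Prod>x\<leftarrow>xs. [:-x, 1:]) i" for i
    unfolding xs_def by (subst real_rooted_pos_zeros_desc(2)[OF rr(1)]) (rule coeff_smult)
  have cg: "coeff g i = lead_coeff g * coeff (\<Prod>x\<leftarrow>ys. [:-x, 1:]) i" for i
    unfolding ys_def by (subst real_rooted_pos_zeros_desc(2)[OF rr(2)]) (rule coeff_smult)
  show ?thesis
    using main unfolding cf[of i] cf[of j] cg[of i] cg[of j] by (simp add: mult_ac)
qed auto


section \<open>Half-open decompositions of simplicial fans\<close>

definition open_cone :: "'a::real_vector set \<Rightarrow> 'a set" where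
  "open_cone W = {\<Sum>w\<in>W. c w *\<^sub>R w | c. \<forall>w\<in>W. 0 < c w}"

definition closed_cone :: "'a::real_vector set \<Rightarrow> 'a set" where
  "closed_cone W = {\<Sum>w\<in>W. c w *\<^sub>R w | c. \<forall>w\<in>W. 0 \<le> c w}"

lemma representation_lincomb:
  assumes "independent W" "finite W" "w \<in> W"
  shows "representation W (\<Sum>v\<in>W. c v *\<^sub>R v) w = c w"
proof -
  have "representation W (\<Sum>v\<in>W. c v *\<^sub>R v) w = (\<Sum>v\<in>W. representation W (c v *\<^sub>R v) w)"
    using assms by (subst real_vector.representation_sum) (auto intro: span_base span_scale)
  also have "\<dots> = (\<Sum>v\<in>W. if v = w then c w else 0)"
    using assms by (intro sum.cong)
      (auto simp: real_vector.representation_scale real_vector.representation_basis span_base)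
  finally show ?thesis using assms by simp
qed

lemma lincomb_in_span: "(\<Sum>w\<in>W. c w *\<^sub>R w) \<in> span W"
  by (intro span_sum span_scale span_base)

lemma representation_line:
  assumes "independent W" "z \<in> span W" "q \<in> span W"
  shows "representation W (z + t *\<^sub>R q) w = representation W z w + t * representation W q w"
  using assms by (simp add: real_vector.representation_add real_vector.representation_scale span_scale)

lemma open_cone_iff:
  assumes "independent W" "finite W"
  shows "z \<in> open_cone W \<longleftrightarrow> z \<in> span W \<and> (\<forall>w\<in>W. 0 < representation W z w)"
proof
  assume "z \<in> open_cone W"
  then show "z \<in> span W \<and> (\<forall>w\<in>W. 0 < representation W z w)"
    using assms by (auto simp: open_cone_def representation_lincomb lincomb_in_span)
next
  assume z: "z \<in> span W \<and> (\<forall>w\<in>W. 0 < representation W z w)"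
  then have "z = (\<Sum>w\<in>W. representation W z w *\<^sub>R w)"
    using assms by (metis real_vector.sum_representation_eq order_refl)
  with z show "z \<in> open_cone W" unfolding open_cone_def by blast
qed

lemma closed_cone_iff:
  assumes "independent W" "finite W"
  shows "z \<in> closed_cone W \<longleftrightarrow> z \<in> span W \<and> (\<forall>w\<in>W. 0 \<le> representation W z w)"
proof
  assume "z \<in> closed_cone W"
  then show "z \<in> span W \<and> (\<forall>w\<in>W. 0 \<le> representation W z w)"
    using assms by (auto simp: closed_cone_def representation_lincomb lincomb_in_span)
next
  assume z: "z \<in> span W \<and> (\<forall>w\<in>W. 0 \<le> representation W z w)"
  then have "z = (\<Sum>w\<in>W. representation W z w *\<^sub>R w)"
    using assms by (metis real_vector.sum_representation_eq order_refl)
  with z show "z \<in> closed_cone W" unfolding closed_cone_def by blast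
qed

lemma closed_cone_subset_span: "closed_cone W \<subseteq> span W"
  by (auto simp: closed_cone_def lincomb_in_span)

lemma open_cone_subset_closed_cone: "open_cone W \<subseteq> closed_cone W"
  unfolding open_cone_def closed_cone_def by (auto intro: less_imp_le)

lemma closed_cone_lincomb:
  assumes "finite W" "\<And>i. i \<in> I \<Longrightarrow> v i \<in> closed_cone W" "\<And>i. i \<in> I \<Longrightarrow> 0 \<le> c i"
  shows "(\<Sum>i\<in>I. c i *\<^sub>R v i) \<in> closed_cone W"
proof -
  have "\<forall>i. \<exists>b. i \<in> I \<longrightarrow> (\<forall>w\<in>W. 0 \<le> b w) \<and> v i = (\<Sum>w\<in>W. b w *\<^sub>R w)"
    using assms(2) unfolding closed_cone_def by blast
  then obtain b where b: "\<And>i. i \<in> I \<Longrightarrow> (\<forall>w\<in>W. 0 \<le> b i w) \<and> v i = (\<Sum>w\<in>W. b i w *\<^sub>R w)"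
    by metis
  have "(\<Sum>i\<in>I. c i *\<^sub>R v i) = (\<Sum>i\<in>I. \<Sum>w\<in>W. (c i * b i w) *\<^sub>R w)"
    using b by (intro sum.cong) (auto simp: scaleR_sum_right)
  also have "\<dots> = (\<Sum>w\<in>W. (\<Sum>i\<in>I. c i * b i w) *\<^sub>R w)"
    by (subst sum.swap) (simp add: scaleR_sum_left)
  finally have eq: "(\<Sum>i\<in>I. c i *\<^sub>R v i) = (\<Sum>w\<in>W. (\<Sum>i\<in>I. c i * b i w) *\<^sub>R w)" .
  have "\<forall>w\<in>W. 0 \<le> (\<Sum>i\<in>I. c i * b i w)"
    using b assms(3) by (auto intro!: sum_nonneg mult_nonneg_nonneg)
  then show ?thesis unfolding eq closed_cone_def
    by (intro CollectI exI[of _ "\<lambda>w. \<Sum>i\<in>I. c i * b i w"] conjI refl)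
qed

text \<open>Discarding the generators with coefficient 0 leaves the face of the cone whose relative
  interior contains \<open>z\<close>.\<close>

lemma closed_cone_carrier:
  assumes "finite W" "z \<in> closed_cone W"
  obtains W' where "W' \<subseteq> W" "z \<in> open_cone W'"
proof -
  obtain c where c: "\<forall>w\<in>W. 0 \<le> c w" "z = (\<Sum>w\<in>W. c w *\<^sub>R w)"
    using assms(2) unfolding closed_cone_def by blast
  have "z = (\<Sum>w\<in>{w\<in>W. c w \<noteq> 0}. c w *\<^sub>R w)"
    unfolding c(2) using assms(1) by (intro sum.mono_neutral_right) auto
  moreover have "\<forall>w\<in>{w\<in>W. c w \<noteq> 0}. 0 < c w" using c(1) by (auto simp: less_le)
  ultimately have "z \<in> open_cone {w\<in>W. c w \<noteq> 0}" unfolding open_cone_def by blast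
  then show ?thesis by (intro that) auto
qed

text \<open>The vector is found on a moment curve: on it a nonzero linear functional vanishes only at
  finitely many points.\<close>

lemma generic_vector:
  fixes V :: "'a::euclidean_space set"
  assumes indep: "independent V" and "finite \<U>" and U: "\<And>U. U \<in> \<U> \<Longrightarrow> \<not> V \<subseteq> span U"
  obtains q where "q \<in> span V" "\<And>v. v \<in> V \<Longrightarrow> representation V q v \<noteq> 0"
    "\<And>v. v \<in> V \<Longrightarrow> representation V q v < 0 \<longleftrightarrow> v \<in> K" "\<And>U. U \<in> \<U> \<Longrightarrow> q \<notin> span U"
proof -
  have finV: "finite V" using indep by (rule independent_imp_finite)
  \<comment> \<open>Distinct exponents for distinct basis vectors keep the terms of
    \<open>p U\<close> below from cancelling.\<close>
  obtain idx :: "'a \<Rightarrow> nat" where idx: "inj_on idx V"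
    using finV finite_imp_inj_to_nat_seg by metis
  define s :: "'a \<Rightarrow> real" where "s v = (if v \<in> K then -1 else 1)" for v
  define q where "q t = (\<Sum>v\<in>V. (s v * t ^ idx v) *\<^sub>R v)" for t
  \<comment> \<open>The functional is given by the component orthogonal to \<open>span U\<close> of
    a basis vector \<open>v\<close> outside \<open>span U\<close>.\<close>
  have "\<exists>a v. (\<forall>u\<in>span U. a \<bullet> u = 0) \<and> v \<in> V \<and> a \<bullet> v \<noteq> 0" if "U \<in> \<U>" for U
  proof -
    obtain v where v: "v \<in> V" "v \<notin> span U" using U \<open>U \<in> \<U>\<close> by blast
    obtain y a where y: "y \<in> span U" and a: "\<And>w. w \<in> span U \<Longrightarrow> a \<bullet> w = 0" and ya: "v = y + a"
      using orthogonal_subspace_decomp_exists[of U v] unfolding Linear_Algebra.orthogonal_def by metis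
    have "a \<noteq> 0" using v y ya by auto
    then have "a \<bullet> v \<noteq> 0" using a[OF y] by (simp add: ya inner_add_right)
    with v a show ?thesis by blast
  qed
  then obtain a v where av: "\<And>U u. U \<in> \<U> \<Longrightarrow> u \<in> span U \<Longrightarrow> a U \<bullet> u = 0"
      "\<And>U. U \<in> \<U> \<Longrightarrow> v U \<in> V" "\<And>U. U \<in> \<U> \<Longrightarrow> a U \<bullet> v U \<noteq> 0"
    by metis
  \<comment> \<open>As a polynomial in \<open>t\<close> this is \<open>a U \<bullet> q t\<close>.
    Any \<open>t > 0\<close> that is a root of no \<open>p U\<close> yields a suitable vector, and
    only finitely many \<open>t\<close> are excluded.\<close>
  define p where "p U = (\<Sum>v\<in>V. monom (s v * (a U \<bullet> v)) (idx v))" for U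
  have p: "poly (p U) t = a U \<bullet> q t" for U t
    by (simp add: p_def q_def poly_sum poly_monom inner_sum_right mult_ac)
  have "p U \<noteq> 0" if "U \<in> \<U>" for U
  proof -
    have "coeff (p U) (idx (v U)) = (\<Sum>w\<in>V. if w = v U then s w * (a U \<bullet> w) else 0)"
      unfolding p_def coeff_sum coeff_monom
      using av(2)[OF that] idx by (intro sum.cong) (auto dest: inj_onD)
    also have "\<dots> = s (v U) * (a U \<bullet> v U)" using finV av(2)[OF that] by simp
    also have "\<dots> \<noteq> 0" using av(3)[OF that] by (simp add: s_def)
    finally show ?thesis by auto
  qed
  then have "finite (\<Union>U\<in>\<U>. {t. poly (p U) t = 0})"
    using \<open>finite \<U>\<close> by (auto intro: poly_roots_finite)
  moreover have "infinite {0::real<..}" by (rule infinite_Ioi)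
  ultimately obtain t where t: "0 < t" "\<And>U. U \<in> \<U> \<Longrightarrow> poly (p U) t \<noteq> 0"
    by (smt (verit, best) UN_iff finite_subset greaterThan_iff mem_Collect_eq subsetI)
  have rep: "representation V (q t) v = s v * t ^ idx v" if "v \<in> V" for v
    unfolding q_def using indep finV that by (rule representation_lincomb)
  have pos: "0 < t ^ i" for i using t(1) by simp
  show ?thesis
  proof (rule that[of "q t"])
    show "q t \<in> span V" unfolding q_def by (rule lincomb_in_span)
    show "representation V (q t) v \<noteq> 0" if "v \<in> V" for v
      unfolding rep[OF that] using t(1) by (simp add: s_def)
    show "representation V (q t) v < 0 \<longleftrightarrow> v \<in> K" if "v \<in> V" for v
      unfolding rep[OF that] using t(1) pos[of "idx v"] by (simp add: s_def not_less)
    show "q t \<notin> span U" if "U \<in> \<U>" for U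
      using t(2)[OF that] av(1)[OF that] unfolding p by blast
  qed
qed

section \<open>Small perturbations along a ray\<close>

lemma eventually_affine_pos:
  fixes a b :: real
  assumes "0 < a \<or> a = 0 \<and> 0 < b"
  shows "\<forall>\<^sub>F t in at_right 0. 0 < a + t * b"
proof (cases "0 < a")
  case True
  have "((\<lambda>t. a + t * b) \<longlongrightarrow> a + 0 * b) (at_right 0)" by (intro tendsto_intros)
  then show ?thesis using True by (auto dest: order_tendstoD(1))
next
  case False
  then have "a = 0" "0 < b" using assms by auto
  then show ?thesis
    by (auto intro!: eventually_mono[OF eventually_at_right_less[of "0::real"]])
qed

text \<open>Two distinct parameters at which a line meets a subspace place its direction in that
  subspace.\<close>

lemma frequently_at_right_two:
  fixes P :: "real \<Rightarrow> bool"
  assumes "\<exists>\<^sub>F t in at_right 0. P t"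
  obtains s t where "0 < s" "s < t" "P s" "P t"
proof -
  have ex: "\<exists>t>0. t < e \<and> P t" if "0 < e" for e :: real
  proof -
    have "\<forall>\<^sub>F t in at_right 0. 0 < t \<and> t < e"
      unfolding eventually_at_right_field using that by blast
    with assms show ?thesis by (blast dest: frequently_eventually_frequently frequently_ex)
  qed
  from ex[of 1] obtain t where "0 < t" "P t" by auto
  moreover from ex[of t] \<open>0 < t\<close> obtain s where "0 < s" "s < t" "P s" by auto
  ultimately show ?thesis using that by blast
qed

text \<open>Cones are represented by their sets of generators, so the faces of a cone are the
  subsets. The last three assumptions make the relatively open cones a partition of the simplicial
  cone over \<open>V\<close>.\<close>

locale simplicial_fan =
  fixes V :: "'a::euclidean_space set" and \<F> :: "'a set set"
  assumes finite_fan: "finite \<F>"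
    and independent_base: "independent V"
    and independent_face: "W \<in> \<F> \<Longrightarrow> independent W"
    and subface: "W \<in> \<F> \<Longrightarrow> W' \<subseteq> W \<Longrightarrow> W' \<in> \<F>"
    and face_subset: "W \<in> \<F> \<Longrightarrow> W \<subseteq> closed_cone V"
    and covered: "z \<in> closed_cone V \<Longrightarrow> \<exists>W\<in>\<F>. z \<in> open_cone W"
    and disjoint: "W \<in> \<F> \<Longrightarrow> W' \<in> \<F> \<Longrightarrow> z \<in> open_cone W \<Longrightarrow> z \<in> open_cone W' \<Longrightarrow> W = W'"
begin

text \<open>The generators of the smallest face of the base cone that contains \<open>W\<close>, as
  \<open>supp_subset_iff\<close> shows.\<close>

definition supp :: "'a set \<Rightarrow> 'a set" where
  "supp W = {v \<in> V. \<exists>w\<in>W. representation V w v \<noteq> 0}"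

text \<open>Generators are independent and lie in \<open>span V\<close>, so these are the
  full-dimensional cones.\<close>

definition chambers :: "'a set set" where
  "chambers = {C \<in> \<F>. card C = card V}"

lemma finite_base: "finite V"
  using independent_base by (rule independent_imp_finite)

lemma finite_face: "W \<in> \<F> \<Longrightarrow> finite W"
  by (rule independent_imp_finite[OF independent_face])

lemma closed_cone_face: "W \<in> \<F> \<Longrightarrow> closed_cone W \<subseteq> closed_cone V"
  using closed_cone_lincomb[OF finite_base, of W "\<lambda>w. w"] face_subset
  unfolding closed_cone_def[of W] by blast

lemma face_subset_span: "W \<in> \<F> \<Longrightarrow> W \<subseteq> span V"
  using face_subset closed_cone_subset_span by blast

text \<open>The point \<open>z\<close> lies in the open cone of some subset of \<open>C\<close>, and
  by disjointness that subset is \<open>W\<close>.\<close>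

lemma subset_of_open_cone:
  assumes "W \<in> \<F>" "C \<in> \<F>" "z \<in> open_cone W" "z \<in> closed_cone C"
  shows "W \<subseteq> C"
  using closed_cone_carrier[OF finite_face[OF assms(2)] assms(4)] subface[OF assms(2)]
    disjoint[OF assms(1)] assms(3) by metis

text \<open>The point \<open>\<Sum>W\<close> has non-negative coordinates in \<open>V\<close>,
  positive exactly on \<open>supp W\<close>. A step along \<open>q\<close> leaves the base cone at
  once iff some coordinate that starts at 0 decreases, that is, iff \<open>K\<close> has an element
  outside \<open>supp W\<close>.\<close>

lemma exit_direction:
  assumes W: "W \<in> \<F>" and q: "q \<in> span V" "\<And>v. v \<in> V \<Longrightarrow> representation V q v \<noteq> 0"
    "\<And>v. v \<in> V \<Longrightarrow> representation V q v < 0 \<longleftrightarrow> v \<in> K" and K: "K \<subseteq> V"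
  shows "K \<subseteq> supp W \<Longrightarrow> \<forall>\<^sub>F t in at_right 0. \<Sum>W + t *\<^sub>R q \<in> closed_cone V"
    and "0 < t \<Longrightarrow> \<Sum>W + t *\<^sub>R q \<in> closed_cone V \<Longrightarrow> K \<subseteq> supp W"
proof -
  have span: "\<Sum>W \<in> span V" using face_subset_span[OF W] by (auto intro: span_sum)
  have repw: "0 \<le> representation V w v" if "w \<in> W" "v \<in> V" for w v
    using face_subset[OF W] closed_cone_iff[OF independent_base finite_base] that by blast
  have rep: "representation V (\<Sum>W) v = (\<Sum>w\<in>W. representation V w v)" for v
    using face_subset_span[OF W]
    by (subst real_vector.representation_sum[OF independent_base]) auto
  have rep0: "0 \<le> representation V (\<Sum>W) v" if "v \<in> V" for v
    unfolding rep using repw that by (intro sum_nonneg) auto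
  \<comment> \<open>Nothing cancels, since every generator has non-negative coordinates.\<close>
  have pos: "representation V (\<Sum>W) v \<noteq> 0 \<longleftrightarrow> v \<in> supp W" if "v \<in> V" for v
    unfolding rep using repw that finite_face[OF W]
    by (subst sum_nonneg_eq_0_iff) (auto simp: supp_def)
  have line: "representation V (\<Sum>W + t *\<^sub>R q) v = representation V (\<Sum>W) v + t * representation V q v" for t v
    using independent_base span q(1) by (rule representation_line)
  {
    assume KW: "K \<subseteq> supp W"
    have "\<forall>\<^sub>F t in at_right 0. 0 < representation V (\<Sum>W) v + t * representation V q v"
      if v: "v \<in> V" for v
    proof (rule eventually_affine_pos)
      show "0 < representation V (\<Sum>W) v \<or>
          representation V (\<Sum>W) v = 0 \<and> 0 < representation V q v"
        using rep0[OF v] pos[OF v] q(2,3)[OF v] KW by (metis less_le not_less_iff_gr_or_eq subsetD)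
    qed
    then have "\<forall>\<^sub>F t in at_right 0. \<forall>v\<in>V. 0 < representation V (\<Sum>W) v + t * representation V q v"
      using finite_base by (simp add: eventually_ball_finite)
    then show "\<forall>\<^sub>F t in at_right 0. \<Sum>W + t *\<^sub>R q \<in> closed_cone V"
      by (rule eventually_mono)
        (use span q(1) in \<open>auto simp: closed_cone_iff[OF independent_base finite_base] line
          intro: span_add span_scale less_imp_le\<close>)
  }
  {
    assume t: "0 < t" and cone: "\<Sum>W + t *\<^sub>R q \<in> closed_cone V"
    show "K \<subseteq> supp W"
    proof
      fix v assume v: "v \<in> K"
      then have "v \<in> V" using K by blast
      then have "0 \<le> representation V (\<Sum>W) v + t * representation V q v"
        using cone line closed_cone_iff[OF independent_base finite_base] by metis
      moreover have "t * representation V q v < 0"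
        using v q(3)[OF \<open>v \<in> V\<close>] t by (simp add: mult_pos_neg)
      ultimately have "representation V (\<Sum>W) v \<noteq> 0" by linarith
      then show "v \<in> supp W" using pos[OF \<open>v \<in> V\<close>] by simp
    qed
  }
qed

lemma sum_in_open_cone: "\<Sum>W \<in> open_cone W"
  unfolding open_cone_def by (rule CollectI, rule exI[of _ "\<lambda>_. 1"]) simp

text \<open>Here \<open>R C\<close> consists of the vertices of \<open>C\<close> opposite to the facets that
  separate \<open>C\<close> from a generic vector \<open>q\<close> whose negative coordinates are those in \<open>K\<close>.\<close>

theorem half_open_decomposition:
  assumes K: "K \<subseteq> V"
  obtains R where "\<And>C. R C \<subseteq> C"
    "\<And>W. W \<in> \<F> \<Longrightarrow> card {C \<in> chambers. R C \<subseteq> W \<and> W \<subseteq> C} = (if K \<subseteq> supp W then 1 else 0)"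
proof -
  \<comment> \<open>Avoiding the spans of all lower-dimensional faces forces a ray in direction
    \<open>q\<close> to enter the open cone of a chamber.\<close>
  define \<U> where "\<U> = {U \<in> \<F>. card U < card V}"
  have notspan: "\<not> V \<subseteq> span U" if "U \<in> \<U>" for U
    using that real_vector.independent_span_bound[OF finite_face independent_base, of U]
    by (auto simp: \<U>_def)
  have "finite \<U>" using finite_fan by (simp add: \<U>_def)
  then obtain q where q: "q \<in> span V" "\<And>v. v \<in> V \<Longrightarrow> representation V q v \<noteq> 0"
    "\<And>v. v \<in> V \<Longrightarrow> representation V q v < 0 \<longleftrightarrow> v \<in> K" "\<And>U. U \<in> \<U> \<Longrightarrow> q \<notin> span U"
    using generic_vector[OF independent_base _ notspan, where K = K] by blast
  define R where "R C = {w \<in> C. representation C q w \<le> 0}" for C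
  have top: "C \<in> chambers" if "C \<in> \<F>" "q \<in> span C" for C
  proof -
    have "card C \<le> card V"
      using real_vector.independent_span_bound[OF finite_base independent_face[OF that(1)]]
        face_subset_span[OF that(1)] by blast
    moreover have "\<not> card C < card V" using q(4) that by (auto simp: \<U>_def)
    ultimately show ?thesis using that(1) by (simp add: chambers_def)
  qed
  have spanC: "q \<in> span C" if "C \<in> chambers" for C
  proof -
    have C: "C \<in> \<F>" "card C = card V" using that by (auto simp: chambers_def)
    have "span V \<subseteq> span C"
      by (rule card_ge_dim_independent[OF face_subset_span[OF C(1)] independent_face[OF C(1)]])
        (simp add: C(2) dim_eq_card_independent[OF independent_base])
    then show ?thesis using q(1) by blast
  qed
  \<comment> \<open>In the basis \<open>C\<close> the coordinates of the moving point start at 1 on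
    \<open>W\<close> and at 0 on \<open>C - W\<close>, where those of \<open>q\<close> are positive
    because \<open>R C \<subseteq> W\<close>.\<close>
  have enters: "\<forall>\<^sub>F t in at_right 0. \<Sum>W + t *\<^sub>R q \<in> open_cone C"
    if C: "C \<in> chambers" and W: "R C \<subseteq> W" "W \<subseteq> C" for W C
  proof -
    have CF: "C \<in> \<F>" using C by (simp add: chambers_def)
    have span: "\<Sum>W \<in> span C" using W by (auto intro: span_sum span_base)
    have "representation C (\<Sum>W) w = (\<Sum>v\<in>W. representation C v w)" for w
      using W by (subst real_vector.representation_sum[OF independent_face[OF CF]]) (auto intro: span_base)
    also have "\<dots> w = (\<Sum>v\<in>W. if v = w then 1 else 0)" for w
      using W by (intro sum.cong) (auto simp: real_vector.representation_basis[OF independent_face[OF CF]])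
    also have "\<dots> w = (if w \<in> W then 1 else 0)" for w
      using W finite_subset[OF _ finite_face[OF CF]] by simp
    finally have rep: "representation C (\<Sum>W) w = (if w \<in> W then 1 else 0)" for w .
    have "\<forall>\<^sub>F t in at_right 0. 0 < representation C (\<Sum>W) w + t * representation C q w"
      if "w \<in> C" for w
      using that W by (intro eventually_affine_pos) (auto simp: rep R_def not_le)
    then have "\<forall>\<^sub>F t in at_right 0. \<forall>w\<in>C. 0 < representation C (\<Sum>W) w + t * representation C q w"
      using finite_face[OF CF] by (simp add: eventually_ball_finite)
    then show ?thesis
      by (rule eventually_mono)
        (use span spanC[OF C] in \<open>auto simp: open_cone_iff[OF independent_face[OF CF] finite_face[OF CF]]
          representation_line[OF independent_face[OF CF] span spanC[OF C]] intro: span_add span_scale\<close>)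
  qed
  show ?thesis
  proof (rule that[of R])
    show "R C \<subseteq> C" for C by (auto simp: R_def)
    fix W assume W: "W \<in> \<F>"
    let ?A = "{C \<in> chambers. R C \<subseteq> W \<and> W \<subseteq> C}"
    have unique: "C = C'" if "C \<in> ?A" "C' \<in> ?A" for C C'
    proof -
      have "\<forall>\<^sub>F t in at_right (0::real). \<Sum>W + t *\<^sub>R q \<in> open_cone C \<and> \<Sum>W + t *\<^sub>R q \<in> open_cone C'"
        using that enters by (auto intro: eventually_conj)
      then obtain t where "\<Sum>W + t *\<^sub>R q \<in> open_cone C" "\<Sum>W + t *\<^sub>R q \<in> open_cone C'"
        using eventually_happens trivial_limit_at_right_real by blast
      then show ?thesis using disjoint that by (auto simp: chambers_def)
    qed
    have "?A \<noteq> {} \<longleftrightarrow> K \<subseteq> supp W"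
    proof
      assume "?A \<noteq> {}"
      then obtain C where C: "C \<in> chambers" "R C \<subseteq> W" "W \<subseteq> C" by blast
      have "\<forall>\<^sub>F t in at_right (0::real). 0 < t \<and> \<Sum>W + t *\<^sub>R q \<in> open_cone C"
        using enters[OF C] by (intro eventually_conj eventually_at_right_less)
      then obtain t where "0 < t" "\<Sum>W + t *\<^sub>R q \<in> open_cone C"
        using eventually_happens trivial_limit_at_right_real by blast
      moreover have "open_cone C \<subseteq> closed_cone V"
        using C(1) open_cone_subset_closed_cone closed_cone_face by (force simp: chambers_def)
      ultimately show "K \<subseteq> supp W" using exit_direction(2)[OF W q(1-3) K] by blast
    next
      assume "K \<subseteq> supp W"
      then have "\<forall>\<^sub>F t in at_right 0. \<Sum>W + t *\<^sub>R q \<in> closed_cone V"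
        using exit_direction(1)[OF W q(1-3) K] by blast
      then have "\<forall>\<^sub>F t in at_right 0. \<exists>C\<in>\<F>. \<Sum>W + t *\<^sub>R q \<in> open_cone C"
        by (rule eventually_mono) (rule covered)
      then have freq: "\<exists>\<^sub>F t in at_right (0::real). \<exists>C\<in>\<F>. \<Sum>W + t *\<^sub>R q \<in> open_cone C"
        by (simp add: eventually_frequently)
      \<comment> \<open>There are finitely many cones, so a single one contains points of the ray
        arbitrarily close to its origin.\<close>
      then obtain C where C: "C \<in> \<F>" and freq: "\<exists>\<^sub>F t in at_right (0::real). \<Sum>W + t *\<^sub>R q \<in> open_cone C"
        using frequently_bex_finite[OF finite_fan freq] by blast
      note indC = independent_face[OF C] and finC = finite_face[OF C]
      obtain s t where st: "0 < s" "s < t" "\<Sum>W + s *\<^sub>R q \<in> span C" "\<Sum>W + t *\<^sub>R q \<in> span C"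
        using frequently_at_right_two[OF freq] open_cone_iff[OF indC finC] by metis
      have "(t - s) *\<^sub>R q = (\<Sum>W + t *\<^sub>R q) - (\<Sum>W + s *\<^sub>R q)" by (simp add: algebra_simps)
      also have "\<dots> \<in> span C" using st by (intro span_diff)
      finally have "inverse (t - s) *\<^sub>R ((t - s) *\<^sub>R q) \<in> span C" by (rule span_scale)
      then have qC: "q \<in> span C" using st(2) by simp
      then have WC: "\<Sum>W \<in> span C" using st(4) by (metis add_diff_cancel span_diff span_scale)
      \<comment> \<open>Otherwise this coordinate is non-positive for all small
        \<open>t > 0\<close>. Its first entry gives \<open>W \<subseteq> C\<close> via the closed
        cone; off \<open>W\<close>, where the first entry vanishes, the second gives
        \<open>R C \<subseteq> W\<close>.\<close>
      have nonneg: "0 < representation C (\<Sum>W) w \<or> representation C (\<Sum>W) w = 0 \<and> 0 < representation C q w"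
        if w: "w \<in> C" for w
      proof (rule ccontr)
        let ?a = "representation C (\<Sum>W) w" and ?b = "representation C q w"
        assume neg: "\<not> ?thesis"
        have "\<forall>\<^sub>F t in at_right 0. \<not> 0 < ?a + t * ?b"
        proof (cases "?a = 0")
          case True
          then have "?b \<le> 0" using neg by simp
          then show ?thesis using True
            by (intro eventually_mono[OF eventually_at_right_less[of "0::real"]])
              (simp add: mult_nonneg_nonpos not_less)
        next
          case False
          then have "\<forall>\<^sub>F t in at_right 0. 0 < - ?a + t * (- ?b)"
            using neg by (intro eventually_affine_pos) auto
          then show ?thesis by (rule eventually_mono) simp
        qed
        moreover have "\<exists>\<^sub>F t in at_right 0. 0 < ?a + t * ?b"
          using freq by (rule frequently_elim1)
            (use w in \<open>auto simp: open_cone_iff[OF indC finC] representation_line[OF indC WC qC]\<close>)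
        ultimately show False by (simp add: frequently_def)
      qed
      then have "\<forall>w\<in>C. 0 \<le> representation C (\<Sum>W) w" by (metis less_imp_le order_refl)
      then have "\<Sum>W \<in> closed_cone C" using WC by (simp add: closed_cone_iff[OF indC finC])
      then have sub: "W \<subseteq> C" by (rule subset_of_open_cone[OF W C sum_in_open_cone])
      have "representation C (\<Sum>W) w = 0" if "w \<in> C" "w \<notin> W" for w
      proof -
        have "representation C (\<Sum>W) w = (\<Sum>v\<in>W. representation C v w)"
          using sub by (subst real_vector.representation_sum[OF indC]) (auto intro: span_base)
        also have "\<dots> = 0"
          using sub that by (intro sum.neutral) (auto simp: real_vector.representation_basis[OF indC])
        finally show ?thesis .
      qed
      then have "R C \<subseteq> W" using nonneg unfolding R_def by fastforce
      with sub top[OF C qC] show "?A \<noteq> {}" by blast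
    qed
    moreover have "card ?A = 1" if "?A \<noteq> {}"
      using unique that by (metis (no_types, lifting) is_singletonI' is_singleton_altdef)
    ultimately show "card ?A = (if K \<subseteq> supp W then 1 else 0)" by (metis (no_types, lifting) card.empty)
  qed
qed

text \<open>Double counting of the pairs \<open>(W, C)\<close> with
  \<open>R C \<subseteq> W \<subseteq> C\<close>. Since faces are closed under subsets, each
  interval \<open>[R C, C]\<close> is a full Boolean lattice and is counted by binomial
  coefficients.\<close>

corollary face_count_supp:
  assumes "K \<subseteq> V"
  obtains R where "\<And>C. R C \<subseteq> C"
    "\<And>i. card {W \<in> \<F>. card W = i \<and> K \<subseteq> supp W} =
       (\<Sum>C\<in>chambers. if card (R C) \<le> i then (card V - card (R C)) choose (i - card (R C)) else 0)"
proof -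
  obtain R where R: "\<And>C. R C \<subseteq> C"
    "\<And>W. W \<in> \<F> \<Longrightarrow> card {C \<in> chambers. R C \<subseteq> W \<and> W \<subseteq> C} = (if K \<subseteq> supp W then 1 else 0)"
    by (rule half_open_decomposition[OF assms]) (rule that)
  have fin: "finite chambers" using finite_fan by (simp add: chambers_def)
  \<comment> \<open>For \<open>i < card (R C)\<close> truncated subtraction would make the binomial
    coefficient 1, so this case is split off with value 0.\<close>
  have interval: "card {W \<in> \<F>. card W = i \<and> R C \<subseteq> W \<and> W \<subseteq> C} =
      (if card (R C) \<le> i then (card V - card (R C)) choose (i - card (R C)) else 0)"
    if "C \<in> chambers" for C i
  proof -
    have C: "C \<in> \<F>" "card C = card V" using that by (auto simp: chambers_def)
    note finC = finite_face[OF C(1)]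
    have finR: "finite (R C)" using R(1) finC finite_subset by blast
    show ?thesis
    proof (cases "card (R C) \<le> i")
      case True
      have "bij_betw (\<lambda>S. R C \<union> S) {S. S \<subseteq> C - R C \<and> card S = i - card (R C)}
          {W \<in> \<F>. card W = i \<and> R C \<subseteq> W \<and> W \<subseteq> C}"
      proof (rule bij_betwI[where g = "\<lambda>W. W - R C"])
        show "(\<lambda>S. R C \<union> S) \<in> {S. S \<subseteq> C - R C \<and> card S = i - card (R C)} \<rightarrow>
            {W \<in> \<F>. card W = i \<and> R C \<subseteq> W \<and> W \<subseteq> C}"
        proof
          fix S assume S: "S \<in> {S. S \<subseteq> C - R C \<and> card S = i - card (R C)}"
          then have "finite S" using finC finite_subset by blast
          then have "card (R C \<union> S) = i"
            using S True finR by (subst card_Un_disjoint) auto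
          moreover have "R C \<union> S \<subseteq> C" using S R(1) by blast
          ultimately show "R C \<union> S \<in> {W \<in> \<F>. card W = i \<and> R C \<subseteq> W \<and> W \<subseteq> C}"
            using subface[OF C(1)] by blast
        qed
        show "(\<lambda>W. W - R C) \<in> {W \<in> \<F>. card W = i \<and> R C \<subseteq> W \<and> W \<subseteq> C} \<rightarrow>
            {S. S \<subseteq> C - R C \<and> card S = i - card (R C)}"
          using finR by (auto simp: card_Diff_subset)
      qed auto
      then have "card {W \<in> \<F>. card W = i \<and> R C \<subseteq> W \<and> W \<subseteq> C} =
          card {S. S \<subseteq> C - R C \<and> card S = i - card (R C)}"
        by (simp add: bij_betw_same_card)
      also have "\<dots> = card (C - R C) choose (i - card (R C))"
        using finC by (intro n_subsets) simp
      finally show ?thesis using True C(2) finR R(1) by (simp add: card_Diff_subset)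
    next
      case False
      have "\<not> (card W = i \<and> R C \<subseteq> W)" if "W \<in> \<F>" for W
        using False card_mono[OF finite_face[OF that], of "R C"] by auto
      then have empty: "{W \<in> \<F>. card W = i \<and> R C \<subseteq> W \<and> W \<subseteq> C} = {}" by blast
      show ?thesis unfolding empty using False by simp
    qed
  qed
  show ?thesis
  proof (rule that[OF R(1)])
    fix i
    let ?F = "{W \<in> \<F>. card W = i}"
    have finF: "finite ?F" using finite_fan by simp
    have "{W \<in> \<F>. card W = i \<and> K \<subseteq> supp W} = {W \<in> ?F. K \<subseteq> supp W}" by auto
    then have "card {W \<in> \<F>. card W = i \<and> K \<subseteq> supp W} = (\<Sum>W\<in>?F. if K \<subseteq> supp W then 1 else 0)"
      using finF by (simp add: sum.If_cases Int_def)
    also have "\<dots> = (\<Sum>W\<in>?F. card {C \<in> chambers. R C \<subseteq> W \<and> W \<subseteq> C})"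
      using R(2) by (intro sum.cong) auto
    also have "\<dots> = (\<Sum>W\<in>?F. \<Sum>C\<in>chambers. if R C \<subseteq> W \<and> W \<subseteq> C then 1 else 0)"
      using fin by (simp add: sum.If_cases Int_def)
    also have "\<dots> = (\<Sum>C\<in>chambers. \<Sum>W\<in>?F. if R C \<subseteq> W \<and> W \<subseteq> C then 1 else 0)"
      by (rule sum.swap)
    also have "\<dots> = (\<Sum>C\<in>chambers. card {W \<in> \<F>. card W = i \<and> R C \<subseteq> W \<and> W \<subseteq> C})"
      using finF by (simp add: sum.If_cases Int_def conj_assoc)
    also have "\<dots> = (\<Sum>C\<in>chambers. if card (R C) \<le> i then (card V - card (R C)) choose (i - card (R C)) else 0)"
      by (intro sum.cong interval refl)
    finally show "card {W \<in> \<F>. card W = i \<and> K \<subseteq> supp W} =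
       (\<Sum>C\<in>chambers. if card (R C) \<le> i then (card V - card (R C)) choose (i - card (R C)) else 0)" .
  qed
qed

end


section \<open>Columns of the transformation matrix\<close>

text \<open>This is \<open>x\<close> to the power \<open>k\<close> times the binomial expansion of
  \<open>(x + (1 - x)) ^ (d - k) = 1\<close>. Thus the face counts of a Boolean interval with bottom
  of size \<open>k\<close> and top of size \<open>d\<close> have a single monomial as
  \<open>h\<close>-polynomial.\<close>

lemma h_basis_expansion:
  assumes "k \<le> d"
  shows "(\<Sum>i\<le>d. smult (if k \<le> i then real ((d - k) choose (i - k)) else 0)
    (monom 1 i * [:1, -1:] ^ (d - i))) = monom (1::real) k"
proof -
  have "(\<Sum>i\<le>d. smult (if k \<le> i then real ((d - k) choose (i - k)) else 0)
      (monom 1 i * [:1, -1:] ^ (d - i)))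
    = (\<Sum>i\<in>{k..d}. smult (real ((d - k) choose (i - k))) (monom 1 i * [:1, -1:] ^ (d - i)))"
    by (intro sum.mono_neutral_cong_right) auto
  also have "\<dots> = (\<Sum>m\<le>d - k. smult (real ((d - k) choose m)) (monom 1 (k + m) * [:1, -1:] ^ (d - k - m)))"
    using assms
    by (intro sum.reindex_bij_witness[of _ "\<lambda>m. k + m" "\<lambda>i. i - k"]) (auto simp: algebra_simps)
  also have "\<dots> = monom 1 k * (\<Sum>m\<le>d - k. of_nat ((d - k) choose m) * monom 1 1 ^ m * [:1, -1:] ^ (d - k - m))"
    unfolding sum_distrib_left
  proof (intro sum.cong refl)
    fix m
    have 1: "monom (1::real) (k + m) = monom 1 k * monom 1 1 ^ m"
      by (simp add: mult_monom monom_power)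
    have 2: "smult (real n) p = of_nat n * p" for n and p :: "real poly"
      by (simp add: of_nat_poly)
    show "smult (real ((d - k) choose m)) (monom 1 (k + m) * [:1, -1:] ^ (d - k - m)) =
        monom 1 k * (of_nat ((d - k) choose m) * monom 1 1 ^ m * [:1, -1:] ^ (d - k - m))"
      unfolding 1 2 by (simp only: mult_ac)
  qed
  also have "(\<Sum>m\<le>d - k. of_nat ((d - k) choose m) * monom 1 1 ^ m * [:1, -1:] ^ (d - k - m))
      = (monom 1 1 + [:1, -1::real:]) ^ (d - k)"
    by (rule binomial_ring[symmetric])
  also have "monom 1 1 + [:1, -1::real:] = 1" by (simp add: monom_altdef one_pCons)
  finally show ?thesis by simp
qed

lemma transformation_matrix_carrier: "transformation_matrix d f \<in> carrier_mat (d + 1) (d + 1)"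
  and transformation_matrix_h_of_f: "v \<in> carrier_vec (d + 1) \<Longrightarrow>
    transformation_matrix d f *\<^sub>v h_of_f d v = h_of_f d (f_transformation_matrix d f *\<^sub>v v)"
  using theI'[OF transformation_matrix_ex1[of d f]] unfolding transformation_matrix_def by blast+

text \<open>Column \<open>k\<close> is the image of a unit vector in \<open>h\<close>-coordinates.
  By \<open>h_basis_expansion\<close> that unit vector comes from the binomial face vector
  \<open>v\<close>, to which the \<open>f\<close>-matrix is applied.\<close>

lemma transformation_matrix_entry:
  assumes "k \<le> d" "l \<le> d"
  shows "transformation_matrix d f $$ (l, k) =
    coeff (\<Sum>i\<le>d. smult (\<Sum>m\<le>d - k. real ((d - k) choose m) * f_transformation_matrix d f $$ (i, k + m))
      (monom 1 i * [:1, -1:] ^ (d - i))) l"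
proof -
  let ?H = "transformation_matrix d f" and ?G = "f_transformation_matrix d f"
  define v where "v = vec (d + 1) (\<lambda>i. if k \<le> i then real ((d - k) choose (i - k)) else 0)"
  have v: "v \<in> carrier_vec (d + 1)" by (simp add: v_def)
  have "(\<Sum>i\<le>d. smult (v $ i) (monom 1 i * [:1, -1:] ^ (d - i))) = monom 1 k"
    unfolding h_basis_expansion[OF assms(1), symmetric] by (intro sum.cong) (auto simp: v_def)
  then have "h_of_f d v = unit_vec (d + 1) k"
    unfolding h_of_f_def by (intro eq_vecI) (auto simp: unit_vec_def)
  then have "?H *\<^sub>v unit_vec (d + 1) k = h_of_f d (?G *\<^sub>v v)"
    using transformation_matrix_h_of_f[OF v, of f] by simp
  moreover have "(?H *\<^sub>v unit_vec (d + 1) k) $ l = ?H $$ (l, k)"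
    using assms transformation_matrix_carrier[of d f]
    by (simp add: mult_mat_vec_def)
  moreover have "(?G *\<^sub>v v) $ i = (\<Sum>m\<le>d - k. real ((d - k) choose m) * ?G $$ (i, k + m))"
    if "i \<le> d" for i
  proof -
    have "(?G *\<^sub>v v) $ i = (\<Sum>j\<in>{0..<d + 1}. ?G $$ (i, j) * v $ j)"
      using that f_transformation_matrix_carrier[of d f] v
      by (auto simp: scalar_prod_def intro!: sum.cong)
    also have "\<dots> = (\<Sum>j\<in>{k..d}. ?G $$ (i, j) * real ((d - k) choose (j - k)))"
      by (intro sum.mono_neutral_cong_right) (auto simp: v_def)
    also have "\<dots> = (\<Sum>m\<le>d - k. real ((d - k) choose m) * ?G $$ (i, k + m))"
      using assms(1)
      by (intro sum.reindex_bij_witness[of _ "\<lambda>m. k + m" "\<lambda>i. i - k"]) (auto simp: algebra_simps)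
    finally show ?thesis .
  qed
  ultimately show ?thesis using assms(2) by (simp add: h_of_f_def)
qed

section \<open>Counting the faces of a fan by their support\<close>

lemma sum_Pow_card:
  fixes h :: "nat \<Rightarrow> 'a::comm_semiring_1"
  assumes "finite A"
  shows "(\<Sum>B\<in>Pow A. h (card B)) = (\<Sum>m\<le>card A. of_nat (card A choose m) * h m)"
proof -
  have "(\<Sum>B\<in>Pow A. h (card B)) = (\<Sum>m\<le>card A. \<Sum>B\<in>{B \<in> Pow A. card B = m}. h (card B))"
    using assms by (intro sum.group[symmetric]) (auto intro: card_mono)
  also have "\<dots> = (\<Sum>m\<le>card A. of_nat (card A choose m) * h m)"
    using assms n_subsets[OF assms] by (intro sum.cong) (auto simp: Pow_def)
  finally show ?thesis .
qed

context simplicial_fan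
begin

text \<open>On \<open>span S\<close> the coordinates in \<open>V\<close> and in \<open>S\<close>
  agree. Support conditions thereby become restrictions of the triangulation to faces of the base
  simplex.\<close>

lemma supp_subset_iff:
  assumes "S \<subseteq> V" "W \<in> \<F>"
  shows "supp W \<subseteq> S \<longleftrightarrow> W \<subseteq> closed_cone S"
proof -
  have indS: "independent S" using independent_base assms(1) by (rule real_vector.independent_mono)
  have finS: "finite S" using finite_base assms(1) finite_subset by blast
  have "w \<in> closed_cone S \<longleftrightarrow> (\<forall>v\<in>V - S. representation V w v = 0)" if "w \<in> W" for w
  proof
    have w: "w \<in> span V" "\<forall>v\<in>V. 0 \<le> representation V w v"
      using face_subset[OF assms(2)] that closed_cone_iff[OF independent_base finite_base] by blast+
    assume z: "\<forall>v\<in>V - S. representation V w v = 0"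
    have "w = (\<Sum>v\<in>V. representation V w v *\<^sub>R v)"
      using real_vector.sum_representation_eq[OF independent_base w(1) finite_base] by simp
    also have "\<dots> = (\<Sum>v\<in>S. representation V w v *\<^sub>R v)"
      using z assms(1) finite_base by (intro sum.mono_neutral_right) auto
    finally show "w \<in> closed_cone S" using w(2) assms(1) unfolding closed_cone_def by blast
  next
    assume "w \<in> closed_cone S"
    then have "w \<in> span S" using closed_cone_subset_span by blast
    then have "representation V w = representation S w"
      by (rule real_vector.representation_extend[OF independent_base _ assms(1)])
    then show "\<forall>v\<in>V - S. representation V w v = 0"
      by (metis DiffD2 real_vector.representation_ne_zero)
  qed
  moreover have "supp W \<subseteq> S \<longleftrightarrow> (\<forall>w\<in>W. \<forall>v\<in>V - S. representation V w v = 0)"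
    by (auto simp: supp_def)
  ultimately show ?thesis by blast
qed

text \<open>Moebius inversion turns the counts for supports inside \<open>S\<close> into counts for
  a prescribed support, which are then summed over all supports containing \<open>K\<close>. The
  inner sum has the shape of an entry of the \<open>f\<close>-matrix, the outer one that in
  \<open>transformation_matrix_entry\<close>.\<close>

lemma face_count_superset:
  assumes "K \<subseteq> V"
    and N: "\<And>S. S \<subseteq> V \<Longrightarrow> real (card {W \<in> \<F>. card W = i \<and> supp W \<subseteq> S}) = N (card S)"
  shows "real (card {W \<in> \<F>. card W = i \<and> K \<subseteq> supp W}) =
    (\<Sum>m\<le>card V - card K. real ((card V - card K) choose m) *
      (\<Sum>l\<le>card K + m. (-1) ^ (card K + m - l) * real ((card K + m) choose l) * N l))"
proof -
  define e where "e J = real (card {W \<in> \<F>. card W = i \<and> supp W = J})" for J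
  define g where "g j = (\<Sum>l\<le>j. (-1) ^ (j - l) * real (j choose l) * N l)" for j
  have group: "real (card {W \<in> \<F>. card W = i \<and> supp W \<in> \<J>}) = sum e \<J>" if "finite \<J>" for \<J>
  proof -
    have "card {W \<in> \<F>. card W = i \<and> supp W \<in> \<J>}
        = card (\<Union>J\<in>\<J>. {W \<in> \<F>. card W = i \<and> supp W = J})"
      by (rule arg_cong[of _ _ card]) blast
    also have "\<dots> = (\<Sum>J\<in>\<J>. card {W \<in> \<F>. card W = i \<and> supp W = J})"
      using finite_fan that by (intro card_UN_disjoint) auto
    finally show ?thesis by (simp add: e_def)
  qed
  \<comment> \<open>The number of faces with support exactly \<open>J\<close> depends on
    \<open>J\<close> only through its size, because \<open>N\<close> does.\<close>
  have e: "e J = g (card J)" if J: "J \<subseteq> V" for J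
  proof -
    have finJ: "finite J" using J finite_base finite_subset by blast
    have "e J = (\<Sum>T\<in>Pow J. (-1) ^ (card J - card T) * sum e (Pow T))"
      by (rule inclusion_exclusion_mobius[OF refl finJ])
    also have "\<dots> = (\<Sum>T\<in>Pow J. (-1) ^ (card J - card T) * N (card T))"
    proof (intro sum.cong refl)
      fix T assume "T \<in> Pow J"
      then have T: "T \<subseteq> V" "finite (Pow T)" using J finJ finite_subset by auto
      show "(-1) ^ (card J - card T) * sum e (Pow T) = (-1) ^ (card J - card T) * N (card T)"
        using group[OF T(2)] N[OF T(1)] by (simp add: Pow_def)
    qed
    also have "\<dots> = g (card J)"
      using sum_Pow_card[OF finJ, of "\<lambda>l. (-1) ^ (card J - l) * N l"] by (simp add: g_def mult_ac)
    finally show ?thesis .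
  qed
  have finK: "finite K" and finVK: "finite (V - K)"
    using assms(1) finite_base finite_subset by auto
  have "{W \<in> \<F>. card W = i \<and> K \<subseteq> supp W} = {W \<in> \<F>. card W = i \<and> supp W \<in> (\<lambda>B. K \<union> B) ` Pow (V - K)}"
  proof -
    have "K \<subseteq> supp W \<longleftrightarrow> supp W \<in> (\<lambda>B. K \<union> B) ` Pow (V - K)" for W
    proof
      assume "K \<subseteq> supp W"
      then have "supp W = K \<union> (supp W - K)" "supp W - K \<in> Pow (V - K)" by (auto simp: supp_def)
      then show "supp W \<in> (\<lambda>B. K \<union> B) ` Pow (V - K)" by blast
    qed auto
    then show ?thesis by blast
  qed
  then have "real (card {W \<in> \<F>. card W = i \<and> K \<subseteq> supp W}) = sum e ((\<lambda>B. K \<union> B) ` Pow (V - K))"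
    using group finVK by simp
  also have "\<dots> = (\<Sum>B\<in>Pow (V - K). e (K \<union> B))"
    by (rule sum.reindex_cong[of "\<lambda>B. K \<union> B"]) (auto simp: inj_on_def)
  also have "\<dots> = (\<Sum>B\<in>Pow (V - K). g (card K + card B))"
  proof (intro sum.cong refl)
    fix B assume B: "B \<in> Pow (V - K)"
    then have "finite B" using finVK finite_subset by blast
    then have "card (K \<union> B) = card K + card B"
      using B finK by (intro card_Un_disjoint) auto
    then show "e (K \<union> B) = g (card K + card B)" using e[of "K \<union> B"] B assms(1) by auto
  qed
  also have "\<dots> = (\<Sum>m\<le>card (V - K). real (card (V - K) choose m) * g (card K + m))"
    using sum_Pow_card[OF finVK, of "\<lambda>m. g (card K + m)"] by simp
  finally show ?thesis using assms(1) finK by (simp add: g_def card_Diff_subset)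
qed

text \<open>The entry turns out to be the number of chambers \<open>C\<close> with
  \<open>card (R C) = l\<close>, for the decomposition belonging to a set \<open>K\<close> of size
  \<open>k\<close>.\<close>

theorem transformation_matrix_nonneg:
  assumes count: "\<And>i S. S \<subseteq> V \<Longrightarrow> i \<le> card S \<Longrightarrow>
      card {W \<in> \<F>. card W = i \<and> supp W \<subseteq> S} = f i (card S)"
    and "k \<le> card V" "l \<le> card V"
  shows "0 \<le> transformation_matrix (card V) f $$ (l, k)"
proof -
  define d where "d = card V"
  obtain K where K: "K \<subseteq> V" "card K = k"
    using assms(2) obtain_subset_with_card_n by metis
  obtain R where R: "\<And>C. R C \<subseteq> C"
    "\<And>i. card {W \<in> \<F>. card W = i \<and> K \<subseteq> supp W} =
       (\<Sum>C\<in>chambers. if card (R C) \<le> i then (card V - card (R C)) choose (i - card (R C)) else 0)"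
    by (rule face_count_supp[OF K(1)]) (rule that)
  \<comment> \<open>This matches the convention in the \<open>f\<close>-matrix that array entries
    with \<open>i > k\<close> count as 0.\<close>
  have few: "card W \<le> card S" if "W \<in> \<F>" "supp W \<subseteq> S" "S \<subseteq> V" for W S
  proof -
    have "W \<subseteq> span S" using supp_subset_iff[OF that(3,1)] that(2) closed_cone_subset_span by blast
    then show ?thesis
      using real_vector.independent_span_bound[OF _ independent_face[OF that(1)]]
        finite_subset[OF that(3) finite_base] by blast
  qed
  have N: "real (card {W \<in> \<F>. card W = i \<and> supp W \<subseteq> S}) = (if i \<le> card S then real (f i (card S)) else 0)"
    if "S \<subseteq> V" for i S
  proof (cases "i \<le> card S")
    case False
    then have "{W \<in> \<F>. card W = i \<and> supp W \<subseteq> S} = {}" using few that by fastforce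
    then show ?thesis using False by (simp only: card.empty of_nat_0 if_False)
  qed (simp add: count[OF that])
  have entry: "(\<Sum>m\<le>d - k. real ((d - k) choose m) * f_transformation_matrix d f $$ (i, k + m))
      = (\<Sum>C\<in>chambers. if card (R C) \<le> i then real ((d - card (R C)) choose (i - card (R C))) else 0)"
    if "i \<le> d" for i
  proof -
    have "(\<Sum>m\<le>d - k. real ((d - k) choose m) * f_transformation_matrix d f $$ (i, k + m))
        = (\<Sum>m\<le>d - k. real ((d - k) choose m) *
            (\<Sum>l\<le>k + m. (-1) ^ (k + m - l) * real ((k + m) choose l) * (if i \<le> l then real (f i l) else 0)))"
      using that assms(2) by (intro sum.cong) (auto simp: f_transformation_matrix_def d_def)
    also have "\<dots> = real (card {W \<in> \<F>. card W = i \<and> K \<subseteq> supp W})"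
      using face_count_superset[OF K(1), of i "\<lambda>j. if i \<le> j then real (f i j) else 0"] N
      by (simp add: K(2) d_def)
    also have "\<dots> = (\<Sum>C\<in>chambers. if card (R C) \<le> i then real ((d - card (R C)) choose (i - card (R C))) else 0)"
      unfolding R(2) d_def by (simp add: if_distrib cong: if_cong)
    finally show ?thesis .
  qed
  have r: "card (R C) \<le> d" if "C \<in> chambers" for C
    using card_mono[OF finite_face R(1)] that unfolding chambers_def d_def by force
  have "transformation_matrix d f $$ (l, k) =
      coeff (\<Sum>i\<le>d. \<Sum>C\<in>chambers.
        smult (if card (R C) \<le> i then real ((d - card (R C)) choose (i - card (R C))) else 0)
          (monom 1 i * [:1, -1:] ^ (d - i))) l"
    using assms(2,3) unfolding d_def[symmetric]
    by (subst transformation_matrix_entry)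
      (auto simp: entry smult_sum[symmetric] simp del: mult_pCons_left mult_pCons_right
        intro!: arg_cong[of _ _ "\<lambda>p. coeff p l"] sum.cong)
  \<comment> \<open>After exchanging the sums, each chamber contributes one instance of
    \<open>h_basis_expansion\<close>.\<close>
  also have "\<dots> = coeff (\<Sum>C\<in>chambers. monom 1 (card (R C))) l"
    by (subst sum.swap) (simp only: h_basis_expansion r cong: sum.cong)
  also have "\<dots> \<ge> 0" by (auto simp: coeff_sum intro: sum_nonneg)
  finally show ?thesis unfolding d_def .
qed

end


section \<open>Triangulated simplices as fans\<close>

text \<open>Placing points at height 1 turns affine independence into linear independence and
  simplices into simplicial cones.\<close>

definition homogenize :: "'a \<Rightarrow> 'a::euclidean_space \<times> real" where
  "homogenize p = (p, 1)"

lemma inj_homogenize: "inj_on homogenize A"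
  by (auto simp: inj_on_def homogenize_def)

lemma sum_homogenize:
  "(\<Sum>w\<in>homogenize ` C. c w *\<^sub>R w) =
     (\<Sum>p\<in>C. c (homogenize p) *\<^sub>R p, \<Sum>p\<in>C. c (homogenize p))"
  by (subst sum.reindex[OF inj_homogenize]) (simp add: homogenize_def sum_prod)

lemma independent_homogenize:
  assumes "\<not> affine_dependent C"
  shows "independent (homogenize ` C)"
proof -
  have fin: "finite C" using assms by (rule aff_independent_finite)
  show ?thesis
  proof
    assume "dependent (homogenize ` C)"
    then obtain u where u: "\<exists>w\<in>homogenize ` C. u w \<noteq> 0" "(\<Sum>w\<in>homogenize ` C. u w *\<^sub>R w) = 0"
      using fin by (auto simp: real_vector.dependent_finite)
    then have "(\<Sum>p\<in>C. u (homogenize p) *\<^sub>R p) = 0" "(\<Sum>p\<in>C. u (homogenize p)) = 0"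
      unfolding sum_homogenize by (simp_all add: zero_prod_def)
    with u(1) assms show False
      unfolding affine_dependent_explicit_finite[OF fin] by blast
  qed
qed

text \<open>The last coordinate forces the coefficients of a conic combination to sum to 1, so it is
  a convex combination.\<close>

lemma homogenize_in_closed_cone:
  assumes "finite C"
  shows "homogenize p \<in> closed_cone (homogenize ` C) \<longleftrightarrow> p \<in> convex hull C"
proof
  assume "homogenize p \<in> closed_cone (homogenize ` C)"
  then obtain c where "\<forall>w\<in>homogenize ` C. 0 \<le> c w" "homogenize p = (\<Sum>w\<in>homogenize ` C. c w *\<^sub>R w)"
    unfolding closed_cone_def by blast
  then have "\<forall>x\<in>C. 0 \<le> c (homogenize x)" "(\<Sum>x\<in>C. c (homogenize x)) = 1"
    "(\<Sum>x\<in>C. c (homogenize x) *\<^sub>R x) = p"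
    unfolding sum_homogenize by (auto simp: homogenize_def)
  then show "p \<in> convex hull C" unfolding convex_hull_finite[OF assms]
    by (intro CollectI exI[of _ "\<lambda>x. c (homogenize x)"]) simp
next
  assume "p \<in> convex hull C"
  then obtain u where u: "\<forall>x\<in>C. 0 \<le> u x" "sum u C = 1" "(\<Sum>x\<in>C. u x *\<^sub>R x) = p"
    unfolding convex_hull_finite[OF assms] by blast
  then have "homogenize p = (\<Sum>w\<in>homogenize ` C. u (fst w) *\<^sub>R w)"
    unfolding sum_homogenize by (simp add: homogenize_def)
  moreover have "\<forall>w\<in>homogenize ` C. 0 \<le> u (fst w)" using u(1) by (auto simp: homogenize_def)
  ultimately show "homogenize p \<in> closed_cone (homogenize ` C)"
    unfolding closed_cone_def by (intro CollectI exI[of _ "\<lambda>w. u (fst w)"] conjI)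
qed

lemma homogenize_in_open_cone:
  assumes "\<not> affine_dependent C"
  shows "homogenize p \<in> open_cone (homogenize ` C) \<longleftrightarrow> p \<in> rel_interior (convex hull C)"
proof
  assume "homogenize p \<in> open_cone (homogenize ` C)"
  then obtain c where "\<forall>w\<in>homogenize ` C. 0 < c w" "homogenize p = (\<Sum>w\<in>homogenize ` C. c w *\<^sub>R w)"
    unfolding open_cone_def by blast
  then have "\<forall>x\<in>C. 0 < c (homogenize x)" "(\<Sum>x\<in>C. c (homogenize x)) = 1"
    "(\<Sum>x\<in>C. c (homogenize x) *\<^sub>R x) = p"
    unfolding sum_homogenize by (auto simp: homogenize_def)
  then show "p \<in> rel_interior (convex hull C)"
    unfolding rel_interior_convex_hull_explicit[OF assms]
    by (intro CollectI exI[of _ "\<lambda>x. c (homogenize x)"]) simp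
next
  assume "p \<in> rel_interior (convex hull C)"
  then obtain u where u: "\<forall>x\<in>C. 0 < u x" "sum u C = 1" "(\<Sum>x\<in>C. u x *\<^sub>R x) = p"
    unfolding rel_interior_convex_hull_explicit[OF assms] by blast
  then have "homogenize p = (\<Sum>w\<in>homogenize ` C. u (fst w) *\<^sub>R w)"
    unfolding sum_homogenize by (simp add: homogenize_def)
  moreover have "\<forall>w\<in>homogenize ` C. 0 < u (fst w)" using u(1) by (auto simp: homogenize_def)
  ultimately show "homogenize p \<in> open_cone (homogenize ` C)"
    unfolding open_cone_def by (intro CollectI exI[of _ "\<lambda>w. u (fst w)"] conjI)
qed

lemma scale_open_cone:
  assumes "0 < r" "z \<in> open_cone W"
  shows "r *\<^sub>R z \<in> open_cone W"
proof -
  obtain c where c: "\<forall>w\<in>W. 0 < c w" "z = (\<Sum>w\<in>W. c w *\<^sub>R w)"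
    using assms(2) unfolding open_cone_def by blast
  then have "r *\<^sub>R z = (\<Sum>w\<in>W. (r * c w) *\<^sub>R w)" by (simp add: scaleR_sum_right)
  moreover have "\<forall>w\<in>W. 0 < r * c w" using c(1) assms(1) by simp
  ultimately show ?thesis
    unfolding open_cone_def by (intro CollectI exI[of _ "\<lambda>w. r * c w"] conjI)
qed

lemma scale_closed_cone:
  assumes "0 \<le> r" "z \<in> closed_cone W"
  shows "r *\<^sub>R z \<in> closed_cone W"
proof -
  obtain c where c: "\<forall>w\<in>W. 0 \<le> c w" "z = (\<Sum>w\<in>W. c w *\<^sub>R w)"
    using assms(2) unfolding closed_cone_def by blast
  then have "r *\<^sub>R z = (\<Sum>w\<in>W. (r * c w) *\<^sub>R w)" by (simp add: scaleR_sum_right)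
  moreover have "\<forall>w\<in>W. 0 \<le> r * c w" using c(1) assms(1) by simp
  ultimately show ?thesis
    unfolding closed_cone_def by (intro CollectI exI[of _ "\<lambda>w. r * c w"] conjI)
qed

text \<open>The height \<open>snd z\<close> is the sum of the non-negative coefficients: it vanishes
  only at the origin, and otherwise division by it moves \<open>z\<close> to height 1.\<close>

lemma closed_cone_homogenize_cases:
  assumes "finite C" "z \<in> closed_cone (homogenize ` C)"
  obtains "z = 0" | r p where "0 < r" "z = r *\<^sub>R homogenize p"
proof -
  obtain c where c: "\<forall>w\<in>homogenize ` C. 0 \<le> c w" "z = (\<Sum>w\<in>homogenize ` C. c w *\<^sub>R w)"
    using assms(2) unfolding closed_cone_def by blast
  then have snd: "snd z = (\<Sum>p\<in>C. c (homogenize p))" unfolding sum_homogenize by simp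
  have nonneg: "0 \<le> snd z" unfolding snd using c(1) by (auto intro: sum_nonneg)
  show ?thesis
  proof (cases "snd z = 0")
    case True
    then have "\<forall>p\<in>C. c (homogenize p) = 0"
      unfolding snd using assms(1) c(1) by (subst (asm) sum_nonneg_eq_0_iff) auto
    then have "z = 0" unfolding c(2) by (intro sum.neutral) auto
    then show ?thesis by (rule that(1))
  next
    case False
    then have "z = snd z *\<^sub>R homogenize (fst z /\<^sub>R snd z)"
      by (simp add: homogenize_def prod_eq_iff)
    then show ?thesis using False nonneg that(2) by (metis less_le)
  qed
qed

lemma zero_in_open_cone_iff:
  fixes W :: "'a::euclidean_space set"
  assumes "independent W"
  shows "0 \<in> open_cone W \<longleftrightarrow> W = {}"
  using open_cone_iff[OF assms independent_imp_finite[OF assms], of 0]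
  by (auto simp: real_vector.representation_zero span_zero)

lemma simplex_carrier:
  fixes C :: "'a::euclidean_space set"
  assumes "\<not> affine_dependent C" "x \<in> convex hull C"
  obtains D where "D \<subseteq> C" "x \<in> rel_interior (convex hull D)"
proof -
  have fin: "finite C" using assms(1) by (rule aff_independent_finite)
  have "homogenize x \<in> closed_cone (homogenize ` C)"
    using homogenize_in_closed_cone[OF fin] assms(2) by blast
  then obtain W where W: "W \<subseteq> homogenize ` C" "homogenize x \<in> open_cone W"
    using closed_cone_carrier[OF finite_imageI[OF fin]] by metis
  obtain D where D: "D \<subseteq> C" "W = homogenize ` D" using W(1) by (rule subset_imageE)
  have "\<not> affine_dependent D" using assms(1) D(1) affine_dependent_subset by blast
  then show ?thesis using that D W(2) homogenize_in_open_cone by blast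
qed

section \<open>From triangulated simplices to fans of vertex sets\<close>

lemma convex_hull_affine_independent_inj:
  fixes C D :: "'a::euclidean_space set"
  assumes "\<not> affine_dependent C" "\<not> affine_dependent D" "convex hull C = convex hull D"
  shows "C = D"
  using extreme_point_of_convex_hull_affine_independent[OF assms(1)]
    extreme_point_of_convex_hull_affine_independent[OF assms(2)] unfolding assms(3) by blast

definition vertex_cones :: "'a::euclidean_space set set \<Rightarrow> ('a \<times> real) set set" where
  "vertex_cones \<T> = {homogenize ` C | C. \<not> affine_dependent C \<and> convex hull C \<in> \<T>}"

lemma simplicial_complex_simplexE:
  assumes "simplicial_complex \<T>" "G \<in> \<T>"
  obtains C where "\<not> affine_dependent C" "G = convex hull C"
  using assms unfolding simplicial_complex_def simplex_def by metis

lemma restriction_simplicial_complex: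
  assumes "simplicial_complex \<T>"
  shows "simplicial_complex (restriction \<T> F)"
  using assms unfolding simplicial_complex_def restriction_def
  by (auto 0 4 dest: face_of_imp_subset)

text \<open>A point of \<open>F\<close> lies in some \<open>G \<in> \<Delta>'\<close> inside some
  \<open>F' \<in> \<Delta>\<close>. As \<open>F' \<inter> F\<close> is a face of \<open>F'\<close>,
  its trace on \<open>G\<close> is a face of \<open>G\<close>, hence a simplex of the triangulation
  inside \<open>F\<close>.\<close>

lemma subdivides_restriction_Union:
  assumes "subdivides \<Delta>' \<Delta>" "F \<in> \<Delta>"
  shows "\<Union>(restriction \<Delta>' F) = F"
proof
  show "\<Union>(restriction \<Delta>' F) \<subseteq> F" by (auto simp: restriction_def)
  show "F \<subseteq> \<Union>(restriction \<Delta>' F)"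
  proof
    fix x assume x: "x \<in> F"
    have c: "simplicial_complex \<Delta>'" "simplicial_complex \<Delta>" and U: "\<Union>\<Delta>' = \<Union>\<Delta>"
      and sub: "\<forall>G\<in>\<Delta>'. \<exists>F\<in>\<Delta>. G \<subseteq> F" using assms(1) by (auto simp: subdivides_def)
    from x assms(2) U obtain G where G: "G \<in> \<Delta>'" "x \<in> G" by blast
    then obtain F' where F': "F' \<in> \<Delta>" "G \<subseteq> F'" using sub by blast
    have "F' \<inter> F face_of F'" using c(2) assms(2) F'(1) unfolding simplicial_complex_def by blast
    moreover have "convex G" using simplicial_complex_simplexE[OF c(1) G(1)] convex_convex_hull by metis
    ultimately have "F' \<inter> F \<inter> G face_of F' \<inter> G" by (rule face_of_slice)
    moreover have "F' \<inter> F \<inter> G = G \<inter> (F' \<inter> F)" "F' \<inter> G = G" using F'(2) by auto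
    ultimately have "G \<inter> (F' \<inter> F) face_of G" by simp
    then have "G \<inter> (F' \<inter> F) \<in> restriction \<Delta>' F"
      using c(1) G(1) unfolding simplicial_complex_def restriction_def by blast
    moreover have "x \<in> G \<inter> (F' \<inter> F)" using G x F' by blast
    ultimately show "x \<in> \<Union>(restriction \<Delta>' F)" by blast
  qed
qed

text \<open>At height 1 the covering and disjointness conditions say that the relative interiors of
  the simplices partition their union, which holds because any two simplices meet in a common
  face.\<close>

lemma simplicial_fan_vertex_cones:
  assumes T: "simplicial_complex \<T>" and U: "\<Union>\<T> = convex hull B" and ne: "\<T> \<noteq> {}"
    and B: "\<not> affine_dependent B"
  shows "simplicial_fan (homogenize ` B) (vertex_cones \<T>)"
proof
  have finB: "finite B" using B by (rule aff_independent_finite)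
  have face_closed: "\<And>F S. S \<in> \<T> \<Longrightarrow> F face_of S \<Longrightarrow> F \<in> \<T>"
    and Int_face: "\<And>S S'. S \<in> \<T> \<Longrightarrow> S' \<in> \<T> \<Longrightarrow> S \<inter> S' face_of S"
    using T unfolding simplicial_complex_def by blast+
  have sub: "\<not> affine_dependent D \<and> convex hull D \<in> \<T>"
    if "\<not> affine_dependent C" "convex hull C \<in> \<T>" "D \<subseteq> C" for C D
  proof
    show "\<not> affine_dependent D" using that(1,3) affine_dependent_subset by blast
    have "convex hull D face_of convex hull C"
      unfolding face_of_convex_hull_affine_independent[OF that(1)] using that(3) by blast
    then show "convex hull D \<in> \<T>" by (rule face_closed[OF that(2)])
  qed
  \<comment> \<open>Finiteness: the vertices of a simplex are recovered from it as its extreme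
    points.\<close>
  have "vertex_cones \<T> \<subseteq> (\<lambda>G. homogenize ` {x. x extreme_point_of G}) ` \<T>"
  proof
    fix W assume "W \<in> vertex_cones \<T>"
    then obtain C where C: "\<not> affine_dependent C" "convex hull C \<in> \<T>" "W = homogenize ` C"
      by (auto simp: vertex_cones_def)
    then have "{x. x extreme_point_of convex hull C} = C"
      by (simp add: extreme_point_of_convex_hull_affine_independent)
    then have "W = homogenize ` {x. x extreme_point_of convex hull C}" using C(3) by simp
    then show "W \<in> (\<lambda>G. homogenize ` {x. x extreme_point_of G}) ` \<T>"
      using C(2) by (rule image_eqI)
  qed
  then show "finite (vertex_cones \<T>)"
    using T finite_subset unfolding simplicial_complex_def by blast
  show "independent (homogenize ` B)" using B by (rule independent_homogenize)
  show indW: "independent W" if "W \<in> vertex_cones \<T>" for W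
    using that independent_homogenize by (auto simp: vertex_cones_def)
  show "W' \<in> vertex_cones \<T>" if "W \<in> vertex_cones \<T>" "W' \<subseteq> W" for W W'
    using that sub unfolding vertex_cones_def by (auto elim!: subset_imageE)
  show "W \<subseteq> closed_cone (homogenize ` B)" if "W \<in> vertex_cones \<T>" for W
  proof -
    obtain C where C: "convex hull C \<in> \<T>" "W = homogenize ` C"
      using \<open>W \<in> vertex_cones \<T>\<close> by (auto simp: vertex_cones_def)
    then have "C \<subseteq> convex hull B" using U hull_subset[of C convex] by blast
    then show ?thesis using C(2) homogenize_in_closed_cone[OF finB] by blast
  qed
  show "\<exists>W\<in>vertex_cones \<T>. z \<in> open_cone W" if z: "z \<in> closed_cone (homogenize ` B)" for z
    using finB z
  proof (cases rule: closed_cone_homogenize_cases)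
    \<comment> \<open>The origin belongs to the open cone of the empty face, an empty sum.\<close>
    case 1
    obtain G where "G \<in> \<T>" using ne by blast
    then obtain C where "\<not> affine_dependent C" "convex hull C \<in> \<T>"
      using simplicial_complex_simplexE[OF T] by metis
    then have "homogenize ` {} \<in> vertex_cones \<T>" using sub[of C "{}"] unfolding vertex_cones_def by blast
    moreover have "z \<in> open_cone (homogenize ` {})" using 1 by (simp add: open_cone_def)
    ultimately show ?thesis by blast
  next
    case (2 r p)
    have "homogenize p = inverse r *\<^sub>R z" using 2 by simp
    then have "homogenize p \<in> closed_cone (homogenize ` B)"
      using scale_closed_cone[OF _ z, of "inverse r"] 2(1) by simp
    then have "p \<in> \<Union>\<T>" unfolding U using homogenize_in_closed_cone[OF finB] by blast
    then obtain G where G: "G \<in> \<T>" "p \<in> G" by blast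
    then obtain C where C: "\<not> affine_dependent C" "convex hull C \<in> \<T>" "p \<in> convex hull C"
      using simplicial_complex_simplexE[OF T] by metis
    obtain D where D: "D \<subseteq> C" "p \<in> rel_interior (convex hull D)"
      using simplex_carrier[OF C(1,3)] by metis
    note indD = sub[OF C(1,2) D(1)]
    have "z \<in> open_cone (homogenize ` D)"
      unfolding 2(2) using 2(1) indD D(2) homogenize_in_open_cone scale_open_cone by blast
    moreover have "homogenize ` D \<in> vertex_cones \<T>" using indD unfolding vertex_cones_def by blast
    ultimately show ?thesis by blast
  qed
  show "W = W'" if W: "W \<in> vertex_cones \<T>" "W' \<in> vertex_cones \<T>"
    and z: "z \<in> open_cone W" "z \<in> open_cone W'" for W W' z
  proof -
    obtain C where C: "\<not> affine_dependent C" "convex hull C \<in> \<T>" "W = homogenize ` C"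
      using W(1) by (auto simp: vertex_cones_def)
    obtain D where D: "\<not> affine_dependent D" "convex hull D \<in> \<T>" "W' = homogenize ` D"
      using W(2) by (auto simp: vertex_cones_def)
    have "z \<in> closed_cone (homogenize ` C)" using z(1) C(3) open_cone_subset_closed_cone by blast
    with aff_independent_finite[OF C(1)] show ?thesis
    proof (cases rule: closed_cone_homogenize_cases)
      case 1
      then show ?thesis using z zero_in_open_cone_iff indW W by metis
    next
      case (2 r p)
      have hp: "homogenize p = inverse r *\<^sub>R z" using 2 by simp
      have "0 < inverse r" using 2(1) by simp
      then have "homogenize p \<in> open_cone W" "homogenize p \<in> open_cone W'"
        unfolding hp using z scale_open_cone by blast+
      then have p: "p \<in> rel_interior (convex hull C)" "p \<in> rel_interior (convex hull D)"
        using C D homogenize_in_open_cone by blast+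
      have face: "convex hull C \<inter> convex hull D face_of convex hull C"
        "convex hull D \<inter> convex hull C face_of convex hull D"
        using Int_face C(2) D(2) by blast+
      have pCD: "p \<in> convex hull C" "p \<in> convex hull D" using p rel_interior_subset by blast+
      \<comment> \<open>A face that meets the relative interior of a convex set is the whole
        set.\<close>
      have "convex hull C \<subseteq> convex hull C \<inter> convex hull D"
        by (rule subset_of_face_of[OF face(1)]) (use p pCD in auto)
      moreover have "convex hull D \<subseteq> convex hull D \<inter> convex hull C"
        by (rule subset_of_face_of[OF face(2)]) (use p pCD in auto)
      ultimately have "convex hull C = convex hull D" by blast
      then show ?thesis using convex_hull_affine_independent_inj[OF C(1) D(1)] C(3) D(3) by blast
    qed
  qed
qed

text \<open>Forgetting the height and taking the hull is a bijection from generator sets to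
  simplices; \<open>i\<close> vertices correspond to dimension \<open>i - 1\<close>.\<close>

lemma face_number_vertex_cones:
  assumes T: "simplicial_complex \<T>" and S: "finite S"
  shows "card {W \<in> vertex_cones \<T>. card W = i \<and> W \<subseteq> closed_cone (homogenize ` S)} =
    face_number (restriction \<T> (convex hull S)) (int i - 1)"
proof -
  let ?A = "{W \<in> vertex_cones \<T>. card W = i \<and> W \<subseteq> closed_cone (homogenize ` S)}"
  let ?B = "{G \<in> restriction \<T> (convex hull S). aff_dim G = int i - 1}"
  let ?\<phi> = "\<lambda>W. convex hull (fst ` W)"
  have fst: "fst ` homogenize ` C = C" for C :: "'a set"
    by (force simp: homogenize_def image_iff)
  have mem: "homogenize ` C \<in> ?A \<longleftrightarrow> convex hull C \<in> ?B"
    if C: "\<not> affine_dependent C" for C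
  proof -
    have "homogenize ` C \<in> vertex_cones \<T> \<longleftrightarrow> convex hull C \<in> \<T>"
      using C fst unfolding vertex_cones_def by (auto; metis)
    moreover have "card (homogenize ` C) = i \<longleftrightarrow> aff_dim (convex hull C) = int i - 1"
      using aff_dim_affine_independent[OF C] by (auto simp: card_image inj_homogenize aff_dim_convex_hull)
    moreover have "homogenize ` C \<subseteq> closed_cone (homogenize ` S) \<longleftrightarrow> convex hull C \<subseteq> convex hull S"
      using homogenize_in_closed_cone[OF S] by (metis (no_types, lifting) convex_convex_hull
          hull_minimal hull_subset image_subset_iff subset_eq)
    ultimately show ?thesis by (auto simp: restriction_def)
  qed
  have "bij_betw ?\<phi> ?A ?B"
  proof (rule bij_betwI')
    fix W W' assume "W \<in> ?A" "W' \<in> ?A"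
    then obtain C D where C: "\<not> affine_dependent C" "W = homogenize ` C"
      and D: "\<not> affine_dependent D" "W' = homogenize ` D"
      unfolding vertex_cones_def by blast
    show "?\<phi> W = ?\<phi> W' \<longleftrightarrow> W = W'"
      unfolding C(2) D(2) fst inj_image_eq_iff[OF inj_homogenize]
      using convex_hull_affine_independent_inj[OF C(1) D(1)] by blast
  next
    fix W assume W: "W \<in> ?A"
    then obtain C where C: "\<not> affine_dependent C" "W = homogenize ` C"
      unfolding vertex_cones_def by blast
    show "?\<phi> W \<in> ?B"
      unfolding C(2) fst by (rule iffD1[OF mem[OF C(1)]]) (use W C(2) in simp)
  next
    fix G assume G: "G \<in> ?B"
    then have "G \<in> \<T>" by (simp add: restriction_def)
    then obtain C where C: "\<not> affine_dependent C" "G = convex hull C"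
      using simplicial_complex_simplexE[OF T] by metis
    have "homogenize ` C \<in> ?A" by (rule iffD2[OF mem[OF C(1)]]) (use G C(2) in simp)
    then show "\<exists>W\<in>?A. G = ?\<phi> W" by (rule bexI[rotated]) (simp only: fst C(2))
  qed
  then show ?thesis unfolding face_number_def by (rule bij_betw_same_card)
qed

lemma restriction_restriction: "S \<subseteq> F \<Longrightarrow> restriction (restriction \<T> F) S = restriction \<T> S"
  by (auto simp: restriction_def)

text \<open>A single face \<open>F\<close> of dimension \<open>d - 1\<close> suffices: its faces
  realize every size up to \<open>d\<close>, so uniformity determines all counts demanded by
  \<open>transformation_matrix_nonneg\<close> for the fan over the triangulation of
  \<open>F\<close>.\<close>

theorem uniform_subdivision_nonneg:
  assumes "1 \<le> d" "uniform_subdivision TYPE('a::euclidean_space) d f" "k \<le> d" "l \<le> d"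
  shows "0 \<le> transformation_matrix d f $$ (l, k)"
proof -
  obtain \<Delta>' \<Delta> :: "'a set set" where ut: "uniform_triangulation d f \<Delta>' \<Delta>"
    using assms(2) unfolding uniform_subdivision_def by blast
  then have sd: "subdivides \<Delta>' \<Delta>" and dim: "has_complex_dim \<Delta> (int d - 1)"
    and uni: "\<And>i j F. i \<le> j \<Longrightarrow> j \<le> d \<Longrightarrow> F \<in> \<Delta> \<Longrightarrow> aff_dim F = int j - 1 \<Longrightarrow>
      face_number (restriction \<Delta>' F) (int i - 1) = f i j"
    unfolding uniform_triangulation_def by blast+
  have sc: "simplicial_complex \<Delta>'" "simplicial_complex \<Delta>"
    using sd by (auto simp: subdivides_def)
  obtain F where F: "F \<in> \<Delta>" "aff_dim F = int d - 1" using dim by (auto simp: has_complex_dim_def)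
  obtain B where B: "\<not> affine_dependent B" "F = convex hull B"
    using simplicial_complex_simplexE[OF sc(2) F(1)] .
  let ?T = "restriction \<Delta>' F"
  have cardB: "card B = d"
    using aff_dim_affine_independent[OF B(1)] F(2) by (simp add: B(2) aff_dim_convex_hull)
  have finB: "finite B" using B(1) by (rule aff_independent_finite)
  have scT: "simplicial_complex ?T" using sc(1) by (rule restriction_simplicial_complex)
  have U: "\<Union>?T = convex hull B" using subdivides_restriction_Union[OF sd F(1)] B(2) by simp
  have face: "convex hull S \<in> \<Delta>" "aff_dim (convex hull S) = int (card S) - 1" if "S \<subseteq> B" for S
  proof -
    show "convex hull S \<in> \<Delta>"
    proof -
      have "convex hull S face_of F"
        unfolding B(2) face_of_convex_hull_affine_independent[OF B(1)] using that by blast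
      then show ?thesis using sc(2) F(1) unfolding simplicial_complex_def by blast
    qed
    have "\<not> affine_dependent S" using B(1) that affine_dependent_subset by blast
    then show "aff_dim (convex hull S) = int (card S) - 1"
      using aff_dim_affine_independent by (fastforce simp: aff_dim_convex_hull)
  qed
  \<comment> \<open>This is where \<open>1 \<le> d\<close> enters: a nonempty union guarantees that
    the restriction has a simplex, hence an empty face.\<close>
  have "B \<noteq> {}" using cardB assms(1) by auto
  then have "?T \<noteq> {}" using U by (metis Union_empty convex_hull_eq_empty)
  then interpret fan: simplicial_fan "homogenize ` B" "vertex_cones ?T"
    using simplicial_fan_vertex_cones[OF scT U _ B(1)] by blast
  have card_hom: "card (homogenize ` S) = card S" for S :: "'a set"
    by (rule card_image[OF inj_homogenize])
  have "card {W \<in> vertex_cones ?T. card W = i \<and> fan.supp W \<subseteq> S'} = f i (card S')"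
    if S': "S' \<subseteq> homogenize ` B" "i \<le> card S'" for i S'
  proof -
    obtain S where S: "S \<subseteq> B" "S' = homogenize ` S" using S'(1) by (rule subset_imageE)
    have cS: "card S \<le> d" using card_mono[OF finB S(1)] cardB by simp
    have "{W \<in> vertex_cones ?T. card W = i \<and> fan.supp W \<subseteq> S'} =
        {W \<in> vertex_cones ?T. card W = i \<and> W \<subseteq> closed_cone (homogenize ` S)}"
      using fan.supp_subset_iff[OF S'(1)] unfolding S(2) by blast
    then have "card {W \<in> vertex_cones ?T. card W = i \<and> fan.supp W \<subseteq> S'} =
        face_number (restriction ?T (convex hull S)) (int i - 1)"
      using face_number_vertex_cones[OF scT finite_subset[OF S(1) finB]] by simp
    also have "restriction ?T (convex hull S) = restriction \<Delta>' (convex hull S)"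
      using S(1) by (intro restriction_restriction) (simp add: B(2) hull_mono)
    also have "face_number \<dots> (int i - 1) = f i (card S)"
      using S'(2) cS by (intro uni face[OF S(1)]) (simp_all add: S(2) card_hom)
    finally show ?thesis by (simp add: S(2) card_hom)
  qed
  then show ?thesis
    using fan.transformation_matrix_nonneg[of f k l] assms(3,4) by (simp add: card_hom cardB)
qed

theorem theorem5p1:
  fixes d :: nat and f :: "nat \<Rightarrow> nat \<Rightarrow> nat"
  assumes "d \<ge> 1"
    and "uniform_subdivision TYPE('a::euclidean_space) d f"
    and "interlacing_property d f"
  shows "TP2 (transformation_matrix d f)"
proof -
  let ?H = "transformation_matrix d f"
  have dims: "dim_row ?H = d + 1" "dim_col ?H = d + 1"
    using transformation_matrix_carrier[of d f] by auto
  have nonneg: "0 \<le> ?H $$ (i, j)" if "i \<le> d" "j \<le> d" for i j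
    using uniform_subdivision_nonneg[OF assms(1,2)] that by blast
  \<comment> \<open>The value 0 beyond \<open>d\<close> makes the coefficients non-negative at all
    indices, as \<open>interlaces_minor_nonneg\<close> demands.\<close>
  have coeff: "coeff (column_poly d ?H j) i = (if i \<le> d then ?H $$ (i, j) else 0)" for i j
    by (simp add: column_poly_def coeff_sum)
  have minor: "?H $$ (i, j') * ?H $$ (i', j) \<le> ?H $$ (i, j) * ?H $$ (i', j')"
    if "i < i'" "i' \<le> d" "j < j'" "j' \<le> d" for i i' j j'
  proof -
    have "column_poly d ?H j \<preceq>\<^sub>i column_poly d ?H j'"
      using assms(3) that unfolding interlacing_property_def interlacing_seq_def by blast
    then have "coeff (column_poly d ?H j) i' * coeff (column_poly d ?H j') i
        \<le> coeff (column_poly d ?H j) i * coeff (column_poly d ?H j') i'"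
      using that nonneg by (intro interlaces_minor_nonneg) (auto simp: coeff)
    then show ?thesis using that by (simp add: coeff mult.commute)
  qed
  show ?thesis unfolding TP2_def dims using nonneg minor by auto
qed

end
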